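(* Let $(\mathbf K,\mathbf V,\mathbf P)$ be an ordered valued field with real closure $(\mathbf K^{\mathrm{rc}},\mathbf V^{\mathrm{rc}},\mathbf P^{\mathrm{rc}})$. Let $P$ be a polynomial of degree $d$ in $\mathbf K[X]$ and let $a<b$ in $\mathbf K^{\mathrm{rc}}$ be such that $P^{[k]}(a)P^{[k]}(b)\ge 0$ for $k=0,\ldots,d$. Let $(\sigma_0,\sigma_1,\ldots,\sigma_d)$, $\sigma_i=\pm1$, be the signs of $P,P^{[1]},\ldots,P^{[d]}$ on the open interval $]a,b[$. Let $\epsilon_i=\sigma_0\sigma_i$ (so $\epsilon_0=1$) and $\varepsilon=(\epsilon_1,\ldots,\epsilon_d)$, and consider the generalized Taylor formula (GTF) corresponding to $\varepsilon$. Let $a_k=a$ if $\epsilon_k\epsilon_{k+1}=1$ and $a_k=b$ if $\epsilon_k\epsilon_{k+1}=-1$ (for $0\le k\le d-1$), and let $\nu_k=v(P^{[k]}(a_k))$ for $k=0,\ldots,d$ (where $P^{[d]}$ is a constant, so $\nu_d=v(P^{[d]})$; $\nu_k$ may be infinite if $k<d$). For $x\in[a,b]$ write $x=a+t_1(b-a)$, $e=b-a$, $t_2=1-t_1$, $\delta=v(e)$, $\tau_1=v(t_1)$, $\tau_2=v(t_2)$. Then for $x\in[a,b]$ the valuation $v(P(x))$ is monotonic with respect to $t_1$, and more precisely it can be described as follows. (a) If $\epsilon_1=1$, one can extract from the GTF integers $k_2,\ldots,k_d$ with $1\le k_j\le j$ such that $$v(P(x))=\min(\nu_0,\ \nu_1+\delta+\tau_1,\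 \nu_2+2\delta+k_2\tau_1,\ \ldots,\ \nu_d+d\delta+k_d\tau_1).$$ If $\epsilon_1=-1$, one can extract from the GTF integers $k_2,\ldots,k_d$ with $1\le k_j\le j$ such that $$v(P(x))=\min(\nu_0,\ \nu_1+\delta+\tau_2,\ \nu_2+2\delta+k_2\tau_2,\ \ldots,\ \nu_d+d\delta+k_d\tau_2).$$ (b) So in any case the valuation $v(P(x))$ is: either constant (if $v(P(a))=v(P(b))$); or increasing piecewise linearly with respect to $\tau_1=v\left(\frac{x-a}{b-a}\right)$ (if $v(P(a))>v(P(b))$); or increasing piecewise linearly with respect to $\tau_2=v\left(\frac{b-x}{b-a}\right)$ (if $v(P(a))<v(P(b))$). (c) Setting $\tau=\tau_1-\tau_2=v\left(\frac{t_1}{1-t_1}\right)$, one has $\tau_1=\max(\tau,0)$, $\tau_2=\max(-\tau,0)$, and $v(P(x))$ is monotone and piecewise linear with respect to $\tau$. More precisely, one can extract from the GTF integers $k_2,\ldots,k_d$ with $1\le k_j\le j$ such that $$v(P(x))=\min(\nu_0,\ \nu_1+\delta+\tau',\ \nu_2+2\delta+k_2\tau',\ \ldots,\ \nu_d+d\delta+k_d\tau'),\qquad \tau'=\max(\epsilon_1\tau,0).$$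
   Context: An ordered valued field is a triple $(\mathbf K,\mathbf V,\mathbf P)$ where $\mathbf K$ is an ordered field with set of nonnegative elements $\mathbf P$ ($a\le b$ iff $b-a\in\mathbf P$) and $\mathbf V\subsetneq\mathbf K$ is a valuation ring of $\mathbf K$ that is convex: if $x,y\in\mathbf P$ and $x+y\in\mathbf V$ then $x\in\mathbf V$. The value group $\Gamma_{\mathbf K}=\mathbf K^{\times}/\mathbf V^{\times}$ is written additively and ordered, $v$ is the valuation, $v(0)=+\infty$, $v(x)\ge0$ iff $x\in\mathbf V$. The real closure of $(\mathbf K,\mathbf V,\mathbf P)$ is $(\mathbf K^{\mathrm{rc}},\mathbf V^{\mathrm{rc}},\mathbf P^{\mathrm{rc}})$ where $(\mathbf K^{\mathrm{rc}},\mathbf P^{\mathrm{rc}})$ is the real closure of the ordered field $(\mathbf K,\mathbf P)$ and $\mathbf V^{\mathrm{rc}}$ is the convex hull of $\mathbf V$ in $\mathbf K^{\mathrm{rc}}$; its value group is the divisible hull $\Gamma_{\mathbf K}^{dh}$ of $\Gamma_{\mathbf K}$, and $v$ also denotes its valuation. $P^{[k]}=P^{(k)}/k!$ where $P^{(k)}$ is the $k$-th derivative, $P^{[0]}=P$. The interval $[a,b]$ is taken in $\mathbf K^{\mathrm{rc}}$. Usual conventions for $\pm\infty$ apply ($\tau=+\infty$ at $x=a$ and $\tau=-\infty$ at $x=b$). Generalized Taylor formula (GTF). For variables $a,b,x$, put $e_1=x-a$, $e_2=b-x$. For every sequence $\varepsilon=(\epsilon_1,\ldots,\epsilon_d)$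 in $\{-1,+1\}$, with $\epsilon_0=1$, there is an algebraic identity, for $P$ of degree $d$, $$P(x)=P(a_0)+\sum_{k=1}^{d-1}\epsilon_kH_{k,\varepsilon}(e_1,e_2)P^{[k]}(a_k)+\epsilon_dH_{d,\varepsilon}(e_1,e_2)P^{[d]},$$ where each $H_{k,\varepsilon}$ is a homogeneous polynomial of degree $k$ with nonnegative integer coefficients, $a_k=a$ if $\epsilon_k\epsilon_{k+1}=1$ and $a_k=b$ if $\epsilon_k\epsilon_{k+1}=-1$. Moreover if $\epsilon_1=1$ then $e_1$ divides all $H_{k,\varepsilon}$ and the coefficient of $e_1^k$ in $H_{k,\varepsilon}$ is nonzero; if $\epsilon_1=-1$ then $e_2$ divides all $H_{k,\varepsilon}$ and the coefficient of $e_2^k$ in $H_{k,\varepsilon}$ is nonzero. "Integers extracted from the GTF" means integers, independent of $x$, read off from the polynomials $H_{k,\varepsilon}$. *)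

theory Defs
  imports
    "HOL-Computational_Algebra.Polynomial"
    "HOL-Library.Extended"
begin
text \<open>The order of a linearly ordered field plays the role of the set \<open>P\<close> of nonnegative elements;
  the valuation ring is a class parameter, so that the value group can be formed as a type.\<close>

class ordered_valued_field = linordered_field +
  fixes valring :: "'a set"
  assumes valring_one: "1 \<in> valring"
    and valring_diff: "x \<in> valring \<Longrightarrow> y \<in> valring \<Longrightarrow> x - y \<in> valring"
    and valring_mult: "x \<in> valring \<Longrightarrow> y \<in> valring \<Longrightarrow> x * y \<in> valring"
    and valring_total: "x \<noteq> 0 \<Longrightarrow> x \<in> valring \<or> inverse x \<in> valring"
    and valring_proper: "valring \<noteq> UNIV"
    and valring_convex: "0 \<le> x \<Longrightarrow> 0 \<le> y \<Longrightarrow> x + y \<in> valring \<Longrightarrow> x \<in> valring"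

lemma valring_zero: "0 \<in> valring"
  using valring_diff[OF valring_one valring_one] by simp

definition valunits :: "'a::ordered_valued_field set" where
  "valunits = {u \<in> valring. u \<noteq> 0 \<and> inverse u \<in> valring}"

lemma valunits_one: "1 \<in> valunits"
  by (simp add: valunits_def valring_one)

lemma valunits_mult: "u \<in> valunits \<Longrightarrow> w \<in> valunits \<Longrightarrow> u * w \<in> valunits"
  by (simp add: valunits_def valring_mult)

lemma valunits_inverse: "u \<in> valunits \<Longrightarrow> inverse u \<in> valunits"
  by (simp add: valunits_def)

definition value_eq :: "'a::ordered_valued_field \<Rightarrow> 'a \<Rightarrow> bool" where
  "value_eq x y \<longleftrightarrow> x \<noteq> 0 \<and> y \<noteq> 0 \<and> y / x \<in> valunits"

lemma part_equivp_value_eq: "part_equivp (value_eq :: 'a::ordered_valued_field \<Rightarrow> 'a \<Rightarrow> bool)"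
proof (rule part_equivpI)
  show "\<exists>x::'a. value_eq x x"
    by (rule exI[of _ 1]) (simp add: value_eq_def valunits_one)
  show "symp (value_eq :: 'a \<Rightarrow> 'a \<Rightarrow> bool)"
  proof (rule sympI)
    fix x y :: 'a
    assume "value_eq x y"
    then show "value_eq y x"
      using valunits_inverse[of "y / x"] by (simp add: value_eq_def)
  qed
  show "transp (value_eq :: 'a \<Rightarrow> 'a \<Rightarrow> bool)"
  proof (rule transpI)
    fix x y z :: 'a
    assume "value_eq x y" "value_eq y z"
    then show "value_eq x z"
      using valunits_mult[of "y / x" "z / y"] by (simp add: value_eq_def)
  qed
qed

text \<open>The value group: the quotient of the nonzero elements by the units of the valuation ring,
  written additively, with \<open>[x] \<le> [y]\<close> iff \<open>y / x\<close> lies in the valuation ring.\<close>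

quotient_type (overloaded) 'a value_group = "'a::ordered_valued_field" / partial: value_eq
  by (rule part_equivp_value_eq)

lemma value_eq_iff:
  "value_eq x y \<longleftrightarrow> x \<noteq> 0 \<and> y \<noteq> 0 \<and> y / x \<in> valring \<and> x / y \<in> valring"
  by (auto simp: value_eq_def valunits_def)

instantiation value_group :: (ordered_valued_field) linordered_ab_group_add
begin

lift_definition zero_value_group :: "'a value_group" is 1
  by (simp add: value_eq_def valunits_one)

lift_definition plus_value_group :: "'a value_group \<Rightarrow> 'a value_group \<Rightarrow> 'a value_group" is "(*)"
proof -
  fix x x' y y' :: 'a
  assume "value_eq x x'" "value_eq y y'"
  then show "value_eq (x * y) (x' * y')"
    using valunits_mult[of "x' / x" "y' / y"] by (simp add: value_eq_def)
qed

lift_definition uminus_value_group :: "'a value_group \<Rightarrow> 'a value_group" is inverse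
proof -
  fix x x' :: 'a
  assume "value_eq x x'"
  then show "value_eq (inverse x) (inverse x')"
    using valunits_inverse[of "x' / x"] by (simp add: value_eq_def divide_inverse mult.commute)
qed

definition minus_value_group :: "'a value_group \<Rightarrow> 'a value_group \<Rightarrow> 'a value_group" where
  "minus_value_group g g' = g + - g'"

lift_definition less_eq_value_group :: "'a value_group \<Rightarrow> 'a value_group \<Rightarrow> bool"
  is "\<lambda>x y. y / x \<in> valring"
proof -
  have *: "y' / x' \<in> valring"
    if "value_eq x x'" "value_eq y y'" "y / x \<in> valring" for x x' y y' :: 'a
  proof -
    have "y' / x' = (y' / y) * (y / x) * (x / x')"
      using that by (simp add: value_eq_iff)
    also have "\<dots> \<in> valring"
      using that by (intro valring_mult) (simp_all add: value_eq_iff)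
    finally show ?thesis .
  qed
  show "(y / x \<in> valring) = (y' / x' \<in> valring)"
    if "value_eq x x'" "value_eq y y'" for x x' y y' :: 'a
    using * that by (metis value_eq_iff)
qed

definition less_value_group :: "'a value_group \<Rightarrow> 'a value_group \<Rightarrow> bool" where
  "less_value_group g g' \<longleftrightarrow> g \<le> g' \<and> \<not> g' \<le> g"

instance
proof
  fix g g' g'' :: "'a value_group"
  show "g + g' + g'' = g + (g' + g'')"
    by transfer (simp add: value_eq_def valunits_one ac_simps)
  show "g + g' = g' + g"
    by transfer (simp add: value_eq_def valunits_one ac_simps)
  show "0 + g = g"
    by transfer (simp add: value_eq_def valunits_one)
  show "- g + g = 0"
    by transfer (simp add: value_eq_def valunits_one)
  show "g - g' = g + - g'"
    by (simp add: minus_value_group_def)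
  show "g < g' \<longleftrightarrow> g \<le> g' \<and> \<not> g' \<le> g"
    by (simp add: less_value_group_def)
  show "g \<le> g"
    by transfer (simp add: value_eq_def valring_one)
  show "g \<le> g''" if "g \<le> g'" "g' \<le> g''"
    using that
  proof transfer
    fix x y z :: 'a
    assume "value_eq x x" "value_eq y y" "value_eq z z" "y / x \<in> valring" "z / y \<in> valring"
    then show "z / x \<in> valring"
      using valring_mult[of "y / x" "z / y"] by (simp add: value_eq_def)
  qed
  show "g = g'" if "g \<le> g'" "g' \<le> g"
    using that by transfer (simp add: value_eq_iff)
  show "g'' + g \<le> g'' + g'" if "g \<le> g'"
    using that by transfer (simp add: value_eq_def)
  show "g \<le> g' \<or> g' \<le> g"
  proof transfer
    fix x y :: 'a
    assume "value_eq x x" "value_eq y y"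
    then show "y / x \<in> valring \<or> x / y \<in> valring"
      using valring_total[of "y / x"] by (simp add: value_eq_def)
  qed
qed

end

text \<open>Values lie in the value group extended by \<open>\<plusminus>\<infinity>\<close>; the valuation itself never takes
  the value \<open>-\<infinity>\<close>, which is only needed for differences such as \<open>0 - \<infinity>\<close>.\<close>

definition val :: "'a::ordered_valued_field \<Rightarrow> 'a value_group extended" where
  "val x = (if x = 0 then \<infinity> else Fin (abs_value_group x))"

lemma value_eq_refl: "x \<noteq> 0 \<Longrightarrow> value_eq x x"
  by (simp add: value_eq_def valunits_one)

lemma val_mult: "val (x * y) = val x + val y"
  by (simp add: val_def plus_value_group.abs_eq value_eq_refl)

lemma val_nonneg_iff: "0 \<le> val x \<longleftrightarrow> x \<in> valring"
  by (simp add: valring_zero val_def zero_extended_def zero_value_group_def less_eq_value_group.abs_eq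
      value_eq_refl)

lemma val_le_iff: "x \<noteq> 0 \<Longrightarrow> val x \<le> val y \<longleftrightarrow> y / x \<in> valring"
  by (simp add: valring_zero val_def less_eq_value_group.abs_eq value_eq_refl)

definition real_closed :: "'a::linordered_field itself \<Rightarrow> bool" where
  "real_closed _ \<longleftrightarrow> (\<forall>x::'a. 0 \<le> x \<longrightarrow> (\<exists>y. y ^ 2 = x))
     \<and> (\<forall>p::'a poly. odd (degree p) \<longrightarrow> (\<exists>x. poly p x = 0))"

definition ordered_field_hom :: "('a::linordered_field \<Rightarrow> 'b::linordered_field) \<Rightarrow> bool" where
  "ordered_field_hom h \<longleftrightarrow> h 1 = 1 \<and> (\<forall>x y. h (x + y) = h x + h y)
     \<and> (\<forall>x y. h (x * y) = h x * h y) \<and> (\<forall>x. 0 \<le> x \<longrightarrow> 0 \<le> h x)"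

definition order_convex_hull :: "'a::order set \<Rightarrow> 'a set" where
  "order_convex_hull S = {z. \<exists>x\<in>S. \<exists>y\<in>S. x \<le> z \<and> z \<le> y}"

text \<open>\<open>h\<close> exhibits its codomain as the real closure of its domain, as an ordered valued field.\<close>

definition is_real_closure :: "('k::ordered_valued_field \<Rightarrow> 'r::ordered_valued_field) \<Rightarrow> bool" where
  "is_real_closure h \<longleftrightarrow> ordered_field_hom h \<and> real_closed TYPE('r)
     \<and> (\<forall>z. \<exists>p. p \<noteq> 0 \<and> poly (map_poly h p) z = 0)
     \<and> valring = order_convex_hull (h ` valring)"

text \<open>\<open>P\<^sup>[\<^sup>k\<^sup>]\<close>, the \<open>k\<close>-th derivative divided by \<open>k!\<close>.\<close>

definition divided_deriv :: "nat \<Rightarrow> 'a::field_char_0 poly \<Rightarrow> 'a poly" where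
  "divided_deriv k P = smult (1 / fact k) ((pderiv ^^ k) P)"

text \<open>The point \<open>a\<^sub>k\<close> for \<open>k < d\<close>. At \<open>k = d\<close>, where \<open>P\<^sup>[\<^sup>d\<^sup>]\<close> is constant, the choice of \<open>a\<close> is
  immaterial. Only \<open>\<epsilon> 0, \<dots>, \<epsilon> d\<close> matter, with \<open>\<epsilon> 0 = 1\<close>.\<close>

definition gtf_node :: "nat \<Rightarrow> (nat \<Rightarrow> int) \<Rightarrow> 'a \<Rightarrow> 'a \<Rightarrow> nat \<Rightarrow> 'a" where
  "gtf_node d \<epsilon> a b k = (if k < d \<and> \<epsilon> k * \<epsilon> (Suc k) = -1 then b else a)"

text \<open>A homogeneous polynomial \<open>H\<^sub>k\<close> of degree \<open>k\<close> with coefficients in the natural numbers is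
  represented by its coefficients: \<open>c k i\<close> is the coefficient of \<open>e\<^sub>1\<^sup>i e\<^sub>2\<^sup>k\<^sup>-\<^sup>i\<close>.\<close>

definition binary_form :: "(nat \<Rightarrow> nat) \<Rightarrow> nat \<Rightarrow> 'a::comm_semiring_1 \<Rightarrow> 'a \<Rightarrow> 'a" where
  "binary_form c k x y = (\<Sum>i\<le>k. of_nat (c i) * x ^ i * y ^ (k - i))"

text \<open>Since the rationals form an infinite field, validity of the formula at all rational points
  and for all rational \<open>P\<close> is the same as validity as a formal identity over the integers, and
  it determines the coefficients uniquely (the first conjunct normalises the unused ones to 0).\<close>

definition is_gtf :: "nat \<Rightarrow> (nat \<Rightarrow> int) \<Rightarrow> (nat \<Rightarrow> nat \<Rightarrow> nat) \<Rightarrow> bool" where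
  "is_gtf d \<epsilon> c \<longleftrightarrow>
     (\<forall>k i. \<not> (1 \<le> k \<and> k \<le> d \<and> i \<le> k) \<longrightarrow> c k i = 0) \<and>
     (\<forall>(P :: rat poly) a b x. degree P \<le> d \<longrightarrow>
        poly P x = poly P (gtf_node d \<epsilon> a b 0)
          + (\<Sum>k=1..d. of_int (\<epsilon> k) * binary_form (c k) k (x - a) (b - x)
                        * poly (divided_deriv k P) (gtf_node d \<epsilon> a b k)))"

definition gtf :: "nat \<Rightarrow> (nat \<Rightarrow> int) \<Rightarrow> nat \<Rightarrow> nat \<Rightarrow> nat" where
  "gtf d \<epsilon> = (THE c. is_gtf d \<epsilon> c)"

text \<open>The integer \<open>k\<^sub>j\<close> extracted from the formula: the largest power of \<open>e\<^sub>1\<close> (if \<open>\<epsilon>\<^sub>1 = 1\<close>),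
  respectively of \<open>e\<^sub>2\<close> (if \<open>\<epsilon>\<^sub>1 = -1\<close>), that divides \<open>H\<^sub>j\<close>.\<close>

definition gtf_exponent :: "nat \<Rightarrow> (nat \<Rightarrow> int) \<Rightarrow> nat \<Rightarrow> nat" where
  "gtf_exponent d \<epsilon> j =
     (if \<epsilon> 1 = 1 then (LEAST i. i \<le> j \<and> gtf d \<epsilon> j i \<noteq> 0)
      else (LEAST i. i \<le> j \<and> gtf d \<epsilon> j (j - i) \<noteq> 0))"

text \<open>Integer multiples, with \<open>0 \<cdot> (\<plusminus>\<infinity>) = 0\<close>.\<close>

fun zscale :: "int \<Rightarrow> 'g::linordered_ab_group_add extended \<Rightarrow> 'g extended" where
  "zscale m (Fin g) = Fin (if 0 \<le> m then ((+) g ^^ nat m) 0 else - ((+) g ^^ nat (- m)) 0)"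
| "zscale m \<infinity> = (if m = 0 then 0 else if 0 < m then \<infinity> else -\<infinity>)"
| "zscale m (-\<infinity>) = (if m = 0 then 0 else if 0 < m then -\<infinity> else \<infinity>)"

text \<open>\<open>f\<close> is affine with integer slope on each of finitely many consecutive closed intervals
  (sharing their endpoints) that cover \<open>S\<close>.\<close>

definition piecewise_linear_on ::
  "'g::linordered_ab_group_add extended set \<Rightarrow> ('g extended \<Rightarrow> 'g extended) \<Rightarrow> bool" where
  "piecewise_linear_on S f \<longleftrightarrow>
     (\<exists>n s. (\<forall>i<n. s i \<le> s (Suc i)) \<and> S \<subseteq> {s 0..s n} \<and>
        (\<forall>i<n. \<exists>c m. \<forall>y \<in> S \<inter> {s i..s (Suc i)}. f y = c + zscale m y))"

text \<open>The quantity \<open>F\<close> is, on \<open>A\<close>, an increasing (in the wide sense), respectively monotone,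
  piecewise linear function of the quantity \<open>t\<close>.\<close>

definition increasing_pl_wrt ::
  "'x set \<Rightarrow> ('x \<Rightarrow> 'g::linordered_ab_group_add extended) \<Rightarrow> ('x \<Rightarrow> 'g extended) \<Rightarrow> bool" where
  "increasing_pl_wrt A t F \<longleftrightarrow>
     (\<exists>f. (\<forall>x\<in>A. F x = f (t x)) \<and> mono_on (t ` A) f \<and> piecewise_linear_on (t ` A) f)"

definition monotone_pl_wrt ::
  "'x set \<Rightarrow> ('x \<Rightarrow> 'g::linordered_ab_group_add extended) \<Rightarrow> ('x \<Rightarrow> 'g extended) \<Rightarrow> bool" where
  "monotone_pl_wrt A t F \<longleftrightarrow>
     (\<exists>f. (\<forall>x\<in>A. F x = f (t x)) \<and> (mono_on (t ` A) f \<or> antimono_on (t ` A) f)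
          \<and> piecewise_linear_on (t ` A) f)"

text \<open>\<open>min (\<nu>\<^sub>0, \<nu>\<^sub>1 + \<delta> + k\<^sub>1 y, \<dots>, \<nu>\<^sub>d + d \<delta> + k\<^sub>d y)\<close>.\<close>

definition min_formula ::
  "nat \<Rightarrow> (nat \<Rightarrow> 'g::linordered_ab_group_add extended) \<Rightarrow> 'g extended \<Rightarrow> (nat \<Rightarrow> nat)
     \<Rightarrow> 'g extended \<Rightarrow> 'g extended" where
  "min_formula d \<nu> \<delta> k y =
     Min (insert (\<nu> 0) ((\<lambda>j. \<nu> j + zscale (int j) \<delta> + zscale (int (k j)) y) ` {1..d}))"

definition sign_on :: "'a set \<Rightarrow> ('a \<Rightarrow> 'b::linordered_field) \<Rightarrow> int" where
  "sign_on S f = (THE s. (s = 1 \<or> s = -1) \<and> (\<forall>x\<in>S. sgn (f x) = of_int s))"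

end

theory Submission
  imports Defs
begin

text \<open>The \<open>k\<close>-th form of the Taylor formula is \<open>k!\<close> times an iterated integral, that is,
  \<open>k!\<close> times the volume of the set of zigzags \<open>x, y\<^sub>1, \<dots>, y\<^sub>k\<close> in \<open>[a, b]\<close> that move towards the nodes
  \<open>a\<^sub>0, \<dots>, a\<^sub>k\<^sub>-\<^sub>1\<close>. Cutting this set according to the order type of the zigzag yields the coefficients:
  the coefficient of \<open>e\<^sub>1\<^sup>i e\<^sub>2\<^sup>k\<^sup>-\<^sup>i\<close> is \<open>k choose i\<close> times the number of permutations with prescribed ascents and
  descents and first entry \<open>i\<close>. The formula itself makes every nonconstant \<open>P\<^sup>[\<^sup>k\<^sup>]\<close> strictly monotone between
  \<open>a\<close> and \<open>b\<close>, hence of constant sign, without any intermediate value theorem. With the right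
  \<open>\<epsilon>\<close> all its terms then have the same sign as \<open>P\<close>, and by convexity the valuation of a sum of
  nonnegative elements is the minimum of their valuations. Real closedness only serves to make the
  value group divisible, so that it contains the breakpoints of the resulting minimum of affine
  functions.\<close>

section \<open>The generalized Taylor formula\<close>

text \<open>The number of permutations of \<open>{0..k}\<close> with first entry \<open>i\<close> whose \<open>n\<close>-th step is a descent
  iff \<open>s n\<close>; this is only meaningful for \<open>i \<le> k\<close>. A descent at step \<open>n\<close> corresponds to \<open>a\<^sub>n = a\<close>,
  an ascent to \<open>a\<^sub>n = b\<close>.\<close>

fun zigzag :: "(nat \<Rightarrow> bool) \<Rightarrow> nat \<Rightarrow> nat \<Rightarrow> nat" where
  "zigzag s 0 i = 1"
| "zigzag s (Suc k) i =
     (if s 0 then \<Sum>j<i. zigzag (\<lambda>n. s (Suc n)) k j else \<Sum>j=i..k. zigzag (\<lambda>n. s (Suc n)) k j)"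

text \<open>Starting at the extreme entry, \<open>Suc k\<close> before a descent and
  \<open>0\<close> before an ascent, leaves every continuation open, so this single summand is
  already the positive total for the remaining steps.\<close>

lemma zigzag_sum_pos: "0 < (\<Sum>j\<le>k. zigzag s k j)"
proof (induction k arbitrary: s)
  case (Suc k)
  have "0 < zigzag s (Suc k) (if s 0 then Suc k else 0)"
    using Suc[of "\<lambda>n. s (Suc n)"] by (simp add: atLeast0AtMost lessThan_Suc_atMost del: sum_pos)
  also have "\<dots> \<le> (\<Sum>j\<le>Suc k. zigzag s (Suc k) j)"
    by (rule member_le_sum) auto
  finally show ?case .
qed simp

text \<open>No descent leaves the smallest entry and no ascent leaves the largest; this is why e1,
  respectively e2, divides the forms.\<close>

lemma zigzag_eq_0:
  assumes "1 \<le> k"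
  shows "s 0 \<Longrightarrow> zigzag s k 0 = 0" "\<not> s 0 \<Longrightarrow> zigzag s k k = 0"
  using assms by (cases k; simp)+

lemma zigzag_pos:
  assumes "1 \<le> k"
  shows "s 0 \<Longrightarrow> 0 < zigzag s k k" "\<not> s 0 \<Longrightarrow> 0 < zigzag s k 0"
  using assms zigzag_sum_pos[where s="\<lambda>n. s (Suc n)" and k="k-1"]
  by (cases k; simp add: atLeast0AtMost lessThan_Suc_atMost)+

text \<open>The two sums differ by the single summand \<open>j = i\<close>, with a sign that records
  the direction of the first step.\<close>

lemma zigzag_diff:
  assumes "i \<le> k"
  shows "(of_nat (zigzag s (Suc k) (Suc i)) - of_nat (zigzag s (Suc k) i) :: 'a::ring_1)
      = (if s 0 then 1 else -1) * of_nat (zigzag (\<lambda>n. s (Suc n)) k i)"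
  using assms by (simp add: sum.atLeast_Suc_atMost[of i k])

text \<open>In the intended use the \<open>j\<close>-th factor is
  \<open>\<epsilon> j * \<epsilon> (Suc j)\<close>, so that the product telescopes to
  \<open>\<epsilon> k\<close>.\<close>

definition node_sign :: "(nat \<Rightarrow> bool) \<Rightarrow> nat \<Rightarrow> 'a::comm_ring_1" where
  "node_sign s k = (\<Prod>j<k. if s j then 1 else -1)"

lemma node_sign_0 [simp]: "node_sign s 0 = 1"
  by (simp add: node_sign_def)

lemma node_sign_Suc_shift:
  "node_sign s (Suc k) = (if s 0 then 1 else -1) * node_sign (\<lambda>n. s (Suc n)) k"
  unfolding node_sign_def by (subst prod.lessThan_Suc_shift) simp

section \<open>Binary forms and their derivatives\<close>

definition gtf_coeff :: "(nat \<Rightarrow> bool) \<Rightarrow> nat \<Rightarrow> nat \<Rightarrow> nat" where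
  "gtf_coeff s k i = (k choose i) * zigzag s k i"

text \<open>With e1 = x - a and e2 = b - x the form becomes a polynomial in the single variable x,
  to which \<open>pderiv\<close> applies.\<close>

definition form_poly :: "(nat \<Rightarrow> 'a) \<Rightarrow> nat \<Rightarrow> 'a \<Rightarrow> 'a \<Rightarrow> 'a::comm_ring_1 poly" where
  "form_poly c k a b = (\<Sum>i\<le>k. smult (c i) ([:-a, 1:] ^ i * [:b, -1:] ^ (k - i)))"

lemma poly_form_poly:
  "poly (form_poly (\<lambda>i. of_nat (c i)) k a b) x = binary_form c k (x - a) (b - x)"
  by (simp add: form_poly_def binary_form_def poly_sum algebra_simps)

lemma smult_sum_right: "smult c (\<Sum>i\<in>I. f i) = (\<Sum>i\<in>I. smult c (f i))"
  by (induction I rule: infinite_finite_induct) (simp_all add: smult_add_right)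

lemma pderiv_sum: "pderiv (\<Sum>i\<in>I. f i) = (\<Sum>i\<in>I. pderiv (f i))"
  by (induction I rule: infinite_finite_induct) (simp_all add: pderiv_add)

text \<open>The derivative rule of Bernstein polynomials: the product rule yields one sum from the
  powers of x - a and one from those of b - x. Absorption lowers the binomials to level
  \<open>k\<close>, and the sums combine to forward differences of \<open>f\<close>.\<close>

lemma pderiv_form_poly:
  fixes a b :: "'a::idom"
  shows "pderiv (form_poly (\<lambda>i. of_nat (Suc k choose i) * f i) (Suc k) a b)
    = smult (of_nat (Suc k)) (form_poly (\<lambda>i. of_nat (k choose i) * (f (Suc i) - f i)) k a b)"
proof -
  let ?A = "[:-a, 1:]" and ?B = "[:b, -1:]"
  have pA: "pderiv (?A ^ i) = smult (of_nat i) (?A ^ (i - 1))" for i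
    by (simp add: pderiv_power pderiv_pCons)
  have pB: "pderiv (?B ^ i) = smult (- of_nat i) (?B ^ (i - 1))" for i
    by (simp add: pderiv_power pderiv_pCons)
  have prod_rule: "smult c (p * smult (- n) q' + q * smult m p') = smult (c * m) (p' * q) - smult (c * n) (p * q')"
    for c m n :: 'a and p q p' q'
    by (simp add: smult_diff_right mult.commute)
  have swap: "A * u * n = m * (B * u)" if "A * n = m * B" for A n m B u :: 'a
    using that by algebra
  let ?c = "\<lambda>i. of_nat (Suc k choose i) * f i"
  \<comment> \<open>Here the summand \<open>i = 0\<close> vanishes and the rest is shifted; in the
    second sum it is the summand \<open>i = Suc k\<close> that vanishes.\<close>
  have 1: "(\<Sum>i\<le>Suc k. smult (?c i * of_nat i) (?A ^ (i - 1) * ?B ^ (Suc k - i)))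
     = (\<Sum>i\<le>k. smult (of_nat (Suc k) * (of_nat (k choose i) * f (Suc i))) (?A ^ i * ?B ^ (k - i)))"
    unfolding sum.atMost_Suc_shift of_nat_0 mult_zero_right smult_0_left add_0_left diff_Suc_Suc diff_Suc_1
  proof (intro sum.cong refl)
    fix i
    have "of_nat ((Suc k choose Suc i) * Suc i) = (of_nat (Suc k * (k choose i)) :: 'a)"
      by (simp only: Suc_times_binomial_eq)
    then show "smult (of_nat (Suc k choose Suc i) * f (Suc i) * of_nat (Suc i)) (?A ^ i * ?B ^ (k - i))
      = smult (of_nat (Suc k) * (of_nat (k choose i) * f (Suc i))) (?A ^ i * ?B ^ (k - i))"
      by (subst swap[of _ _ "of_nat (Suc k)" "of_nat (k choose i)"]) (simp_all only: of_nat_mult)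
  qed
  have 2: "(\<Sum>i\<le>Suc k. smult (?c i * of_nat (Suc k - i)) (?A ^ i * ?B ^ (Suc k - i - 1)))
     = (\<Sum>i\<le>k. smult (of_nat (Suc k) * (of_nat (k choose i) * f i)) (?A ^ i * ?B ^ (k - i)))"
    unfolding sum.atMost_Suc diff_self_eq_0 of_nat_0 mult_zero_right smult_0_left add_0_right
  proof (intro sum.cong refl)
    fix i assume "i \<in> {..k}"
    then have "(Suc k choose i) * (Suc k - i) = Suc k * (k choose i)"
      by (metis atMost_iff binomial_absorb_comp diff_Suc_1 mult.commute)
    then have "of_nat ((Suc k choose i) * (Suc k - i)) = (of_nat (Suc k * (k choose i)) :: 'a)"
      by (simp only:)
    moreover have "Suc k - i - 1 = k - i"
      by simp
    ultimately show "smult (?c i * of_nat (Suc k - i)) (?A ^ i * ?B ^ (Suc k - i - 1))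
      = smult (of_nat (Suc k) * (of_nat (k choose i) * f i)) (?A ^ i * ?B ^ (k - i))"
      by (subst swap[of _ _ "of_nat (Suc k)" "of_nat (k choose i)"]) (simp_all only: of_nat_mult)
  qed
  have "pderiv (form_poly ?c (Suc k) a b)
     = (\<Sum>i\<le>Suc k. smult (?c i * of_nat i) (?A ^ (i - 1) * ?B ^ (Suc k - i)))
       - (\<Sum>i\<le>Suc k. smult (?c i * of_nat (Suc k - i)) (?A ^ i * ?B ^ (Suc k - i - 1)))"
    unfolding form_poly_def pderiv_sum pderiv_smult pderiv_mult pA pB
      sum_subtractf[symmetric]
    by (intro sum.cong refl prod_rule)
  also have "\<dots> = smult (of_nat (Suc k)) (form_poly (\<lambda>i. of_nat (k choose i) * (f (Suc i) - f i)) k a b)"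
    unfolding 1 2 form_poly_def smult_sum_right sum_subtractf[symmetric]
    by (intro sum.cong refl) (simp only: smult_smult smult_diff_left[symmetric] right_diff_distrib)
  finally show ?thesis .
qed

text \<open>By \<open>zigzag_diff\<close> the forward differences are, up to sign, the counts for
  the shifted sequence: differentiation strips off the first node.\<close>

lemma pderiv_gtf_form:
  fixes a b :: "'a::idom"
  shows "pderiv (form_poly (\<lambda>i. of_nat (gtf_coeff s (Suc k) i)) (Suc k) a b)
    = smult ((if s 0 then 1 else -1) * of_nat (Suc k))
        (form_poly (\<lambda>i. of_nat (gtf_coeff (\<lambda>n. s (Suc n)) k i)) k a b)"
proof -
  let ?f = "\<lambda>i. of_nat (zigzag s (Suc k) i) :: 'a"
  have "pderiv (form_poly (\<lambda>i. of_nat (gtf_coeff s (Suc k) i)) (Suc k) a b)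
    = smult (of_nat (Suc k)) (form_poly (\<lambda>i. of_nat (k choose i) * (?f (Suc i) - ?f i)) k a b)"
    unfolding gtf_coeff_def of_nat_mult by (rule pderiv_form_poly)
  also have "form_poly (\<lambda>i. of_nat (k choose i) * (?f (Suc i) - ?f i)) k a b
    = smult (if s 0 then 1 else -1) (form_poly (\<lambda>i. of_nat (gtf_coeff (\<lambda>n. s (Suc n)) k i)) k a b)"
    unfolding form_poly_def smult_sum_right
    by (intro sum.cong refl) (simp add: zigzag_diff gtf_coeff_def del: zigzag.simps)
  finally show ?thesis
    by (simp add: mult.commute)
qed

lemma divided_deriv_0 [simp]: "divided_deriv 0 P = P"
  by (simp add: divided_deriv_def)

lemma divided_deriv_Suc:
  "divided_deriv (Suc k) P = smult (1 / of_nat (Suc k)) (divided_deriv k (pderiv P))"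
  by (simp add: divided_deriv_def funpow_swap1 del: of_nat_Suc)

text \<open>At the first node e1 or e2 is zero, so only the pure power of the other survives, and
  its coefficient vanishes by \<open>zigzag_eq_0\<close>. This is the initial condition for the
  integration in the Taylor formula.\<close>

lemma binary_form_gtf_coeff_node:
  fixes a b :: "'a::comm_ring_1"
  assumes "1 \<le> k"
  shows "binary_form (gtf_coeff s k) k ((if s 0 then a else b) - a) (b - (if s 0 then a else b)) = 0"
proof -
  have "of_nat (gtf_coeff s k i) * ((if s 0 then a else b) - a) ^ i * (b - (if s 0 then a else b)) ^ (k - i) = 0"
    if "i \<le> k" for i
    using assms that zigzag_eq_0[of k s]
    by (cases "s 0"; cases "i = 0"; cases "i = k") (simp_all add: gtf_coeff_def power_0_left)
  then show ?thesis
    by (simp add: binary_form_def)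
qed

text \<open>By induction on the degree bound both sides have the same derivative in x, and they
  agree at the first node; in characteristic 0 this makes them equal.\<close>

lemma generalized_Taylor:
  fixes P :: "'a::field_char_0 poly"
  assumes "degree P \<le> d"
  shows "poly P x = (\<Sum>k\<le>d. node_sign s k * binary_form (gtf_coeff s k) k (x - a) (b - x)
                       * poly (divided_deriv k P) (if s k then a else b))"
proof -
  define T where "T = (\<lambda>s d P. \<Sum>k\<le>d. smult (node_sign s k * poly (divided_deriv k P) (if s k then a else b))
      (form_poly (\<lambda>i. of_nat (gtf_coeff s k i)) k a b))"
  have "P = T s d P"
    using assms
  proof (induction d arbitrary: P s)
    case 0
    then obtain c where "P = [:c:]"
      by (metis degree_eq_zeroE le_zero_eq)
    then show ?case
      by (simp add: T_def form_poly_def gtf_coeff_def)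
  next
    case (Suc d)
    \<comment> \<open>The hypothesis is used for the derivative with the node sequence moved on by
      one; hence \<open>s\<close> stays arbitrary in the induction.\<close>
    have IH: "pderiv P = T (\<lambda>n. s (Suc n)) d (pderiv P)"
      using Suc.prems by (intro Suc.IH) (simp add: degree_pderiv)
    have [simp]: "form_poly c 0 a b = [:c 0:]" for c
      by (simp add: form_poly_def)
    have "pderiv (T s (Suc d) P) = T (\<lambda>n. s (Suc n)) d (pderiv P)"
      unfolding T_def sum.atMost_Suc_shift pderiv_add pderiv_sum pderiv_smult pderiv_gtf_form
      by (auto simp add: divided_deriv_Suc node_sign_Suc_shift field_simps simp del: of_nat_Suc
          intro!: sum.cong)
    with IH have "pderiv (P - T s (Suc d) P) = 0"
      by (simp add: pderiv_diff)
    then obtain c where c: "P - T s (Suc d) P = [:c:]"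
      by (metis pderiv_eq_0_iff degree_eq_zeroE)
    let ?x = "if s 0 then a else b"
    have "poly (T s (Suc d) P) ?x = poly P ?x"
      unfolding T_def sum.atMost_Suc_shift poly_add poly_sum poly_smult poly_form_poly
      by (subst sum.neutral) (auto simp: binary_form_gtf_coeff_node gtf_coeff_def binary_form_def[of _ 0] simp del: if_split)
    with c have "c = 0"
      by (metis diff_self poly_diff poly_pCons mult_zero_right poly_0 add.right_neutral)
    with c show ?case by simp
  qed
  then have "poly P x = poly (T s d P) x"
    by simp
  then show ?thesis
    by (simp add: T_def poly_sum poly_form_poly mult_ac)
qed

section \<open>Uniqueness of the coefficients\<close>

lemma divided_deriv_degree_le:
  assumes "degree P \<le> k"
  shows "divided_deriv k P = [:coeff P k:]"
proof (rule poly_eqI)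
  fix n
  show "coeff (divided_deriv k P) n = coeff [:coeff P k:] n"
    using assms
    by (cases n) (auto simp: divided_deriv_def coeff_higher_pderiv pochhammer_fact[symmetric] coeff_eq_0)
qed

text \<open>Setting \<open>y = 1\<close> dehomogenises the form without losing a coefficient, and
  over an infinite field polynomial functions determine polynomials.\<close>

lemma binary_form_inject:
  fixes c c' :: "nat \<Rightarrow> nat"
  assumes "\<And>x y :: 'a::field_char_0. binary_form c k x y = binary_form c' k x y"
    and "i \<le> k"
  shows "c i = c' i"
proof -
  define p where "p = (\<lambda>c :: nat \<Rightarrow> nat. \<Sum>i\<le>k. monom (of_nat (c i) :: 'a) i)"
  have "poly (p c) = poly (p c')"
    using assms(1)[of _ 1] by (simp add: fun_eq_iff p_def poly_sum poly_monom binary_form_def)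
  then have "coeff (p c) i = coeff (p c') i"
    by (simp add: poly_eq_poly_eq_iff)
  then show ?thesis
    using \<open>i \<le> k\<close> by (simp add: p_def coeff_sum)
qed

text \<open>The monomial X^k isolates the k-th form: its k-th divided derivative is 1, the higher
  ones vanish, and the forms below k agree by strong induction.\<close>

lemma is_gtf_unique:
  assumes "is_gtf d \<epsilon> c" "is_gtf d \<epsilon> c'" and \<epsilon>: "\<forall>i\<le>d. \<epsilon> i \<noteq> 0"
  shows "c = c'"
proof -
  have eq: "binary_form (c k) k x y = binary_form (c' k) k x y" if "1 \<le> k" "k \<le> d" for k and x y :: rat
    using that
  proof (induction k arbitrary: x y rule: less_induct)
    case (less k)
    define P where "P = monom (1::rat) k"
    have P: "degree P = k" "coeff P k = 1"
      by (simp_all add: P_def degree_monom_eq)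
    \<comment> \<open>The nodes \<open>0\<close> and \<open>x + y\<close> give e1 = x and e2 = y, so
      the forms are compared at arbitrary arguments.\<close>
    define D where "D = (\<lambda>j. poly (divided_deriv j P) (gtf_node d \<epsilon> 0 (x + y) j))"
    have D: "D k = 1" "\<And>j. k < j \<Longrightarrow> D j = 0"
      using P by (simp_all add: D_def divided_deriv_degree_le coeff_eq_0)
    have *: "poly P x = poly P (gtf_node d \<epsilon> 0 (x + y) 0)
        + (\<Sum>j=1..d. of_int (\<epsilon> j) * binary_form (c j) j x y * D j)"
      if "is_gtf d \<epsilon> c" for c
    proof -
      have "degree P \<le> d"
        using P less.prems by simp
      with that have "poly P x = poly P (gtf_node d \<epsilon> 0 (x + y) 0)
        + (\<Sum>j=1..d. of_int (\<epsilon> j) * binary_form (c j) j (x - 0) (x + y - x)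
            * poly (divided_deriv j P) (gtf_node d \<epsilon> 0 (x + y) j))"
        unfolding is_gtf_def by blast
      then show ?thesis by (simp add: D_def)
    qed
    have "0 = (\<Sum>j=1..d. of_int (\<epsilon> j) * (binary_form (c j) j x y - binary_form (c' j) j x y) * D j)"
      using *[OF assms(1)] *[OF assms(2)] by (simp add: algebra_simps sum_subtractf)
    also have "\<dots> = (\<Sum>j\<in>{k}. of_int (\<epsilon> j) * (binary_form (c j) j x y - binary_form (c' j) j x y) * D j)"
    proof (rule sum.mono_neutral_right)
      show "\<forall>j\<in>{1..d} - {k}. of_int (\<epsilon> j) * (binary_form (c j) j x y - binary_form (c' j) j x y) * D j = 0"
      proof
        fix j assume "j \<in> {1..d} - {k}"
        then show "of_int (\<epsilon> j) * (binary_form (c j) j x y - binary_form (c' j) j x y) * D j = 0"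
          using less.IH[of j x y] D(2)[of j] by (cases "j < k") auto
      qed
    qed (use less.prems in auto)
    finally show ?case
      using \<epsilon> less.prems D by simp
  qed
  have "c k i = c' k i" if "1 \<le> k \<and> k \<le> d \<and> i \<le> k" for k i
    using that eq by (intro binary_form_inject[of "c k" k "c' k" i, where 'a=rat]) auto
  with assms show ?thesis
    unfolding is_gtf_def fun_eq_iff by metis
qed

lemma gtf_coeff_0_0 [simp]: "gtf_coeff s 0 0 = 1"
  by (simp add: gtf_coeff_def)

section \<open>From signs to nodes\<close>

definition keeps_left :: "nat \<Rightarrow> (nat \<Rightarrow> int) \<Rightarrow> nat \<Rightarrow> bool" where
  "keeps_left d \<epsilon> k \<longleftrightarrow> \<not> (k < d \<and> \<epsilon> k * \<epsilon> (Suc k) = -1)"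

lemma gtf_node_eq: "gtf_node d \<epsilon> a b k = (if keeps_left d \<epsilon> k then a else b)"
  by (auto simp: gtf_node_def keeps_left_def)

lemma node_sign_Suc: "node_sign s (Suc k) = node_sign s k * (if s k then 1 else -1)"
  by (simp add: node_sign_def)

lemma node_sign_keeps_left:
  assumes "\<forall>i\<le>d. \<epsilon> i = 1 \<or> \<epsilon> i = -1" "\<epsilon> 0 = 1" "k \<le> d"
  shows "node_sign (keeps_left d \<epsilon>) k = of_int (\<epsilon> k)"
  using assms(3)
proof (induction k)
  case (Suc k)
  then have "\<epsilon> k = 1 \<or> \<epsilon> k = -1" "\<epsilon> (Suc k) = 1 \<or> \<epsilon> (Suc k) = -1"
    using assms(1) by auto
  with Suc show ?case
    by (auto simp: node_sign_Suc keeps_left_def)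
qed (simp add: assms)

lemma gtf_Taylor:
  fixes P :: "'a::field_char_0 poly"
  assumes "\<forall>i\<le>d. \<epsilon> i = 1 \<or> \<epsilon> i = -1" "\<epsilon> 0 = 1" "degree P \<le> d"
  shows "poly P x = poly P (gtf_node d \<epsilon> a b 0)
     + (\<Sum>k=1..d. of_int (\<epsilon> k) * binary_form (gtf_coeff (keeps_left d \<epsilon>) k) k (x - a) (b - x)
                    * poly (divided_deriv k P) (gtf_node d \<epsilon> a b k))"
proof -
  have "poly P x = (\<Sum>k\<le>d. of_int (\<epsilon> k) * binary_form (gtf_coeff (keeps_left d \<epsilon>) k) k (x - a) (b - x)
                    * poly (divided_deriv k P) (gtf_node d \<epsilon> a b k))"
    using assms by (subst generalized_Taylor[OF assms(3), of _ "keeps_left d \<epsilon>" a b])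
      (auto intro!: sum.cong simp: node_sign_keeps_left gtf_node_eq)
  also have "{..d} = insert 0 {1..d}"
    by auto
  finally show ?thesis
    by (simp add: assms binary_form_def[of _ 0])
qed

text \<open>The candidate is cut off to 0 outside the range of the formula, as \<open>is_gtf\<close>
  demands; \<open>gtf_Taylor\<close> and uniqueness then evaluate the definite description.\<close>

lemma gtf_eq:
  assumes "\<forall>i\<le>d. \<epsilon> i = 1 \<or> \<epsilon> i = -1" "\<epsilon> 0 = 1" "1 \<le> k" "k \<le> d" "i \<le> k"
  shows "gtf d \<epsilon> k i = gtf_coeff (keeps_left d \<epsilon>) k i"
proof -
  let ?c = "\<lambda>k i. if 1 \<le> k \<and> k \<le> d \<and> i \<le> k then gtf_coeff (keeps_left d \<epsilon>) k i else 0"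
  have "binary_form (?c k) k x y = binary_form (gtf_coeff (keeps_left d \<epsilon>) k) k x y"
    if "k \<in> {1..d}" for k and x y :: rat
    using that by (auto simp: binary_form_def intro!: sum.cong)
  then have "is_gtf d \<epsilon> ?c"
    unfolding is_gtf_def by (simp del: One_nat_def, blast intro: gtf_Taylor[OF assms(1,2)])
  moreover have "\<forall>i\<le>d. \<epsilon> i \<noteq> 0"
    using assms(1) by force
  ultimately have "gtf d \<epsilon> = ?c"
    unfolding gtf_def by (intro the_equality) (auto dest: is_gtf_unique)
  with assms show ?thesis by simp
qed

section \<open>Constancy of signs\<close>

lemma binary_form_0_right: "binary_form c k x 0 = of_nat (c k) * x ^ k"
proof -
  have "binary_form c k x 0 = (\<Sum>i\<le>k. if i = k then of_nat (c k) * x ^ k else 0)"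
    unfolding binary_form_def by (intro sum.cong refl) (auto simp: power_0_left)
  then show ?thesis by simp
qed

lemma binary_form_commute: "binary_form c k x y = binary_form (\<lambda>i. c (k - i)) k y x"
  unfolding binary_form_def
  by (rule sum.reindex_bij_witness[of _ "\<lambda>i. k - i" "\<lambda>i. k - i"]) (auto simp: mult_ac)

lemma binary_form_mult: "binary_form c k (e * x) (e * y) = e ^ k * binary_form c k x y"
  unfolding binary_form_def sum_distrib_left
proof (intro sum.cong refl)
  fix i assume "i \<in> {..k}"
  then have "e ^ k = e ^ i * e ^ (k - i)"
    by (simp flip: power_add)
  then show "of_nat (c i) * (e * x) ^ i * (e * y) ^ (k - i) = e ^ k * (of_nat (c i) * x ^ i * y ^ (k - i))"
    by (simp add: power_mult_distrib mult_ac)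
qed

lemma binary_form_nonneg:
  fixes x y :: "'a::linordered_field"
  shows "0 \<le> x \<Longrightarrow> 0 \<le> y \<Longrightarrow> 0 \<le> binary_form c k x y"
  by (simp add: binary_form_def sum_nonneg)

text \<open>Taking \<open>\<epsilon>\<^sub>1 = 1\<close> and the formula on \<open>[x, y]\<close> at its right end makes every
  term have the sign \<open>\<sigma>\<^sub>1\<close>; this replaces the mean value theorem.\<close>

lemma strictly_monotone_of_signs:
  fixes P :: "'a::linordered_field poly"
  assumes "1 \<le> degree P" "x < y"
    and \<sigma>: "\<forall>k\<in>{1..degree P}. \<sigma> k = 1 \<or> \<sigma> k = (-1::int)"
    and nonneg: "\<forall>k\<in>{1..degree P}. \<forall>z\<in>{x, y}. 0 \<le> of_int (\<sigma> k) * poly (divided_deriv k P) z"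
  shows "0 < of_int (\<sigma> 1) * (poly P y - poly P x)"
proof -
  let ?d = "degree P"
  define \<epsilon> where "\<epsilon> = (\<lambda>k. if k = 0 then 1 else \<sigma> 1 * \<sigma> k)"
  define s where "s = keeps_left ?d \<epsilon>"
  let ?N = "gtf_node ?d \<epsilon> x y"
  let ?D = "\<lambda>k. poly (divided_deriv k P)"
  have \<sigma>1: "\<sigma> 1 = 1 \<or> \<sigma> 1 = -1"
    using \<sigma> assms(1) by auto
  have \<epsilon>: "\<forall>i\<le>?d. \<epsilon> i = 1 \<or> \<epsilon> i = -1" "\<epsilon> 0 = 1" "\<epsilon> 1 = 1"
    using \<sigma> \<sigma>1 by (force simp: \<epsilon>_def)+
  have "s 0"
    using \<epsilon> by (simp add: s_def keeps_left_def)
  then have "?N 0 = x"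
    by (simp add: gtf_node_eq s_def)
  with gtf_Taylor[OF \<epsilon>(1,2) order_refl, of y x y]
  have "poly P y - poly P x = (\<Sum>k=1..?d. of_int (\<epsilon> k) * (of_nat (gtf_coeff s k k) * (y - x) ^ k) * ?D k (?N k))"
    by (simp add: binary_form_0_right s_def)
  then have "of_int (\<sigma> 1) * (poly P y - poly P x)
      = (\<Sum>k=1..?d. of_int (\<sigma> 1 * \<epsilon> k) * (of_nat (gtf_coeff s k k) * (y - x) ^ k) * ?D k (?N k))"
    by (simp add: sum_distrib_left mult_ac)
  also have "\<dots> = (\<Sum>k=1..?d. (of_nat (gtf_coeff s k k) * (y - x) ^ k) * (of_int (\<sigma> k) * ?D k (?N k)))"
    using \<sigma>1 by (intro sum.cong refl) (auto simp: \<epsilon>_def)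
  also have "\<dots> > 0"
  proof (rule sum_pos2)
    show "0 \<le> (of_nat (gtf_coeff s k k) * (y - x) ^ k) * (of_int (\<sigma> k) * ?D k (?N k))"
      if "k \<in> {1..?d}" for k
      using that nonneg \<open>x < y\<close> by (intro mult_nonneg_nonneg[of "_ * _" "_ * _"]) (auto simp: gtf_node_def)
    \<comment> \<open>The strict inequality comes from the top term: the \<open>?d\<close>-th
      divided derivative is the nonzero leading coefficient, and the top form contains the full
      power of e1 with a positive coefficient.\<close>
    have "\<sigma> ?d = 1 \<or> \<sigma> ?d = -1" "0 \<le> of_int (\<sigma> ?d) * ?D ?d (?N ?d)"
      using \<sigma> nonneg assms(1) by (auto simp: gtf_node_def)
    moreover have "?D ?d (?N ?d) \<noteq> 0"
      using assms(1) by (auto simp: divided_deriv_degree_le)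
    ultimately have "0 < of_int (\<sigma> ?d) * ?D ?d (?N ?d)"
      by force
    moreover have "0 < gtf_coeff s ?d ?d"
      using zigzag_pos(1)[of ?d s] assms(1) \<open>s 0\<close> by (simp add: gtf_coeff_def)
    ultimately show "0 < (of_nat (gtf_coeff s ?d ?d) * (y - x) ^ ?d) * (of_int (\<sigma> ?d) * ?D ?d (?N ?d))"
      using \<open>x < y\<close> by (intro mult_pos_pos[of "_ * _" "_ * _"]) auto
  qed (use assms in auto)
  finally show ?thesis .
qed

text \<open>Induction on the degree through \<open>pderiv P\<close>: the signs of the higher divided
  derivatives make \<open>P\<close> strictly monotone on [a, b], and as its end values do not have
  strictly opposite signs, it cannot change sign inside.\<close>

lemma constant_signs:
  fixes P :: "'a::linordered_field poly"
  assumes "P \<noteq> 0" "a < b"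
    and "\<forall>k\<le>degree P. 0 \<le> poly (divided_deriv k P) a * poly (divided_deriv k P) b"
  shows "\<exists>\<sigma> :: nat \<Rightarrow> int. \<forall>k\<le>degree P. (\<sigma> k = 1 \<or> \<sigma> k = -1)
     \<and> (\<forall>x\<in>{a..b}. 0 \<le> of_int (\<sigma> k) * poly (divided_deriv k P) x)
     \<and> (\<forall>x\<in>{a<..<b}. 0 < of_int (\<sigma> k) * poly (divided_deriv k P) x)"
  using assms
proof (induction "degree P" arbitrary: P)
  case 0
  then obtain c where c: "P = [:c:]" "c \<noteq> 0"
    by (metis degree_eq_zeroE pCons_0_0)
  then show ?case
    by (intro exI[of _ "\<lambda>_. if 0 < c then 1 else -1"]) auto
next
  case (Suc d)
  let ?D = "\<lambda>k. poly (divided_deriv k P)"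
  have deg: "degree (pderiv P) = d"
    using Suc.hyps(2) by (simp add: degree_pderiv)
  have nz: "pderiv P \<noteq> 0"
    using Suc.hyps(2) by (auto simp: pderiv_eq_0_iff)
  have D: "?D (Suc k) x = (1 / of_nat (Suc k)) * poly (divided_deriv k (pderiv P)) x" for k x
    by (simp add: divided_deriv_Suc)
  have "0 \<le> poly (divided_deriv k (pderiv P)) a * poly (divided_deriv k (pderiv P)) b" if "k \<le> d" for k
  proof -
    have "Suc k \<le> degree P"
      using that Suc.hyps(2) by simp
    then have "0 \<le> ?D (Suc k) a * ?D (Suc k) b"
      using Suc.prems by blast
    then have "0 \<le> of_nat (Suc k) ^ 2 * (?D (Suc k) a * ?D (Suc k) b)"
      by (intro mult_nonneg_nonneg[of "_ ^ _"]) auto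
    then show ?thesis
      by (simp add: D power2_eq_square del: of_nat_Suc)
  qed
  with Suc.hyps(1)[of "pderiv P"] nz deg \<open>a < b\<close> obtain \<sigma>' :: "nat \<Rightarrow> int" where
    \<sigma>': "\<forall>k\<le>d. (\<sigma>' k = 1 \<or> \<sigma>' k = -1)
      \<and> (\<forall>x\<in>{a..b}. 0 \<le> of_int (\<sigma>' k) * poly (divided_deriv k (pderiv P)) x)
      \<and> (\<forall>x\<in>{a<..<b}. 0 < of_int (\<sigma>' k) * poly (divided_deriv k (pderiv P)) x)"
    by auto
  define q where "q = (of_int (\<sigma>' 0) :: 'a)"
  \<comment> \<open>The sign \<open>q\<close> is the direction of monotonicity of \<open>P\<close>.
    If \<open>q * poly P a\<close> is nonnegative, \<open>q\<close> times \<open>P\<close> only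
    grows from there; otherwise it is negative at \<open>a\<close>, hence at most 0 at
    \<open>b\<close> by the endpoint condition, and the sign is reversed.\<close>
  define \<sigma> where "\<sigma> = (\<lambda>k. case k of 0 \<Rightarrow> if 0 \<le> q * poly P a then \<sigma>' 0 else - \<sigma>' 0 | Suc j \<Rightarrow> \<sigma>' j)"
  have Suc_case: "(\<sigma> (Suc k) = 1 \<or> \<sigma> (Suc k) = -1)
      \<and> (\<forall>x\<in>{a..b}. 0 \<le> of_int (\<sigma> (Suc k)) * ?D (Suc k) x)
      \<and> (\<forall>x\<in>{a<..<b}. 0 < of_int (\<sigma> (Suc k)) * ?D (Suc k) x)" if "k \<le> d" for k
    using \<sigma>' that by (simp add: D \<sigma>_def del: of_nat_Suc)
  have inc: "q * poly P x < q * poly P y" if "x < y" "x \<in> {a..b}" "y \<in> {a..b}" for x y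
  proof -
    have "\<sigma> k = 1 \<or> \<sigma> k = -1" "\<forall>z\<in>{x, y}. 0 \<le> of_int (\<sigma> k) * ?D k z" if "k \<in> {1..degree P}" for k
      using that Suc_case[of "k - 1"] Suc.hyps(2) \<open>x \<in> {a..b}\<close> \<open>y \<in> {a..b}\<close> by auto
    then have "0 < of_int (\<sigma> 1) * (poly P y - poly P x)"
      using Suc.hyps(2) \<open>x < y\<close> by (intro strictly_monotone_of_signs) auto
    then show ?thesis
      by (simp add: \<sigma>_def q_def right_diff_distrib)
  qed
  have q: "q = 1 \<or> q = -1"
    using \<sigma>' by (auto simp: q_def)
  have ab: "0 \<le> poly P a * poly P b"
    using Suc.prems(3) by (metis divided_deriv_0 le0)
  have "(\<sigma> 0 = 1 \<or> \<sigma> 0 = -1) \<and> (\<forall>x\<in>{a..b}. 0 \<le> of_int (\<sigma> 0) * poly P x)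
      \<and> (\<forall>x\<in>{a<..<b}. 0 < of_int (\<sigma> 0) * poly P x)"
  proof (cases "0 \<le> q * poly P a")
    case True
    have "0 \<le> q * poly P x" if "x \<in> {a..b}" for x
      using inc[of a x] that True by (cases "x = a") auto
    moreover have "0 < q * poly P x" if "x \<in> {a<..<b}" for x
      using inc[of a x] that True by auto
    ultimately show ?thesis
      using True \<sigma>' by (auto simp: \<sigma>_def q_def)
  next
    case False
    then have b: "q * poly P b \<le> 0"
      using ab q by (auto simp: zero_le_mult_iff)
    have "q * poly P x \<le> 0" if "x \<in> {a..b}" for x
      using inc[of x b] that b by (cases "x = b") auto
    moreover have "q * poly P x < 0" if "x \<in> {a<..<b}" for x
      using inc[of x b] that b by auto
    ultimately show ?thesis
      using False \<sigma>' by (auto simp: \<sigma>_def q_def)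
  qed
  with Suc_case have "(\<sigma> k = 1 \<or> \<sigma> k = -1) \<and> (\<forall>x\<in>{a..b}. 0 \<le> of_int (\<sigma> k) * ?D k x)
      \<and> (\<forall>x\<in>{a<..<b}. 0 < of_int (\<sigma> k) * ?D k x)" if "k \<le> degree P" for k
    using that Suc.hyps(2) by (cases k) auto
  then show ?case
    by blast
qed

lemma sign_on_eqI:
  assumes "x \<in> S" "s = 1 \<or> s = -1" "\<And>x. x \<in> S \<Longrightarrow> sgn (f x) = (of_int s :: 'b::linordered_field)"
  shows "sign_on S f = s"
  unfolding sign_on_def
proof (rule the_equality)
  fix s' assume "(s' = 1 \<or> s' = -1) \<and> (\<forall>x\<in>S. sgn (f x) = of_int s')"
  with assms show "s' = s"
    by (metis of_int_eq_iff)
qed (use assms in auto)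

section \<open>Valuations of sums of nonnegative elements\<close>

lemma val_0 [simp]: "val 0 = \<infinity>"
  by (simp add: val_def)

lemma val_1 [simp]: "val 1 = 0"
  by (simp add: val_def zero_extended_def zero_value_group_def)

lemma val_eq_PInf_iff [simp]: "val x = \<infinity> \<longleftrightarrow> x = 0"
  by (simp add: val_def)

lemma val_neq_MInf [simp]: "val x \<noteq> -\<infinity>"
  by (simp add: val_def)

lemma val_minus [simp]: "val (- x) = val x"
proof (cases "x = 0")
  case False
  have "-1 \<in> (valring :: 'a set)"
    using valring_diff[OF valring_zero valring_one] by simp
  with False show ?thesis
    by (intro antisym) (simp_all add: val_le_iff)
qed simp

text \<open>Convexity applied to x/y + (1 - x/y) = 1 puts x/y into the valuation ring.\<close>

lemma val_antimono:
  assumes "0 \<le> x" "x \<le> y"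
  shows "val y \<le> val x"
proof (cases "y = 0")
  case False
  with assms have "x / y \<in> valring"
    using valring_convex[of "x / y" "1 - x / y"] valring_one by simp
  with False show ?thesis
    by (simp add: val_le_iff)
qed (use assms in auto)

lemma val_of_nat:
  assumes "0 < n"
  shows "val (of_nat n) = 0"
proof (rule antisym)
  show "val (of_nat n) \<le> 0"
    using val_antimono[of 1 "of_nat n"] assms by simp
  have "of_nat n \<in> (valring :: 'a set)"
  proof (induction n)
    case (Suc n)
    then show ?case
      using valring_diff[OF valring_one valring_diff[OF valring_zero Suc]] by simp
  qed (simp add: valring_zero)
  then show "0 \<le> val (of_nat n :: 'a)"
    by (simp add: val_nonneg_iff)
qed

lemma val_of_nat_mult:
  "0 < n \<Longrightarrow> val (of_nat n * x) = val x"
  by (simp add: val_mult val_of_nat)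

text \<open>The sum lies between the larger summand and twice that summand, and 2 has value
  0.\<close>

lemma val_add_nonneg:
  assumes "0 \<le> x" "0 \<le> y"
  shows "val (x + y) = min (val x) (val y)"
proof -
  have *: "val (x + y) = min (val x) (val y)" if "0 \<le> y" "y \<le> x" for x y :: 'a
  proof (rule antisym)
    show "val (x + y) \<le> min (val x) (val y)"
      using that by (auto intro: val_antimono)
    have "val (of_nat 2 * x) \<le> val (x + y)"
      using that by (intro val_antimono) auto
    then show "min (val x) (val y) \<le> val (x + y)"
      by (subst (asm) val_of_nat_mult) (auto simp: min_le_iff_disj)
  qed
  show ?thesis
    using *[of x y] *[of y x] assms by (cases "y \<le> x") (auto simp: add.commute min.commute)
qed

lemma val_sum_nonneg:
  assumes "finite I" "I \<noteq> {}" "\<And>i. i \<in> I \<Longrightarrow> 0 \<le> f i"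
  shows "val (\<Sum>i\<in>I. f i) = Min ((\<lambda>i. val (f i)) ` I)"
  using assms
proof (induction rule: finite_ne_induct)
  case (insert i I)
  then show ?case
    by (simp add: val_add_nonneg sum_nonneg)
qed simp

lemma zscale_0 [simp]: "zscale 0 y = 0"
  by (cases y) (auto simp: zero_extended_def)

lemma zscale_Suc: "zscale (int (Suc n)) y = y + zscale (int n) y"
  by (cases y; cases n) (auto simp: zero_extended_def nat_add_distrib simp flip: of_nat_Suc)

lemma val_power: "val (x ^ n) = zscale (int n) (val x)"
  by (induction n) (simp_all add: val_mult zscale_Suc del: of_nat_Suc)

text \<open>Let \<open>m\<close> be the least exponent that occurs. As \<open>x\<close> or \<open>y\<close> is at least \<open>1/2\<close>, the form is bounded
  below by \<open>x\<^sup>m / 2\<^sup>k\<close>, through its term of exponent \<open>k\<close> or \<open>m\<close>, and above by an integer multiple of \<open>x\<^sup>m\<close>.\<close>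

lemma val_binary_form:
  fixes x y :: "'a::ordered_valued_field"
  assumes "0 \<le> x" "0 \<le> y" "x + y = 1" "c k \<noteq> 0"
  shows "val (binary_form c k x y) = zscale (int (LEAST i. i \<le> k \<and> c i \<noteq> 0)) (val x)"
proof -
  define m where "m = (LEAST i. i \<le> k \<and> c i \<noteq> 0)"
  have m: "m \<le> k" "c m \<noteq> 0"
    using LeastI[of "\<lambda>i. i \<le> k \<and> c i \<noteq> 0" k] assms(4) by (auto simp: m_def)
  have least: "m \<le> i" if "i \<le> k" "c i \<noteq> 0" for i
    using that by (auto simp: m_def intro: Least_le)
  have le1: "x \<le> 1" "y \<le> 1"
    using assms by auto
  let ?B = "binary_form c k x y"
  have "?B \<le> (\<Sum>i\<le>k. of_nat (c i) * x ^ m)"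
    unfolding binary_form_def
  proof (rule sum_mono)
    fix i assume i: "i \<in> {..k}"
    show "of_nat (c i) * x ^ i * y ^ (k - i) \<le> of_nat (c i) * x ^ m"
    proof (cases "c i = 0")
      case False
      with i least have "x ^ i \<le> x ^ m"
        using assms le1 by (intro power_decreasing) auto
      moreover have "y ^ (k - i) \<le> 1"
        using assms le1 by (intro power_le_one) auto
      ultimately have "x ^ i * y ^ (k - i) \<le> x ^ m * 1"
        using assms by (intro mult_mono) auto
      then show ?thesis
        using False by (simp add: mult.assoc)
    qed simp
  qed
  also have "\<dots> = of_nat (\<Sum>i\<le>k. c i) * x ^ m"
    by (simp add: sum_distrib_right)
  finally have "val (of_nat (\<Sum>i\<le>k. c i) * x ^ m) \<le> val ?B"
    using assms by (intro val_antimono binary_form_nonneg) auto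
  moreover have "0 < (\<Sum>i\<le>k. c i)"
    using assms(4) by (metis atMost_iff finite_atMost gr0I order_refl sum_eq_0_iff)
  ultimately have "val (x ^ m) \<le> val ?B"
    by (simp only: val_of_nat_mult)
  moreover have "val ?B \<le> val (x ^ m)"
  proof -
    have term_le: "x ^ i * y ^ (k - i) \<le> ?B" if "i \<le> k" "c i \<noteq> 0" for i
    proof -
      have "1 * (x ^ i * y ^ (k - i)) \<le> of_nat (c i) * (x ^ i * y ^ (k - i))"
        using assms that by (intro mult_right_mono) auto
      also have "\<dots> \<le> ?B"
        unfolding binary_form_def mult.assoc
        by (rule member_le_sum) (use assms that in auto)
      finally show ?thesis by simp
    qed
    have "x ^ m \<le> of_nat (2 ^ k) * ?B"
    proof (cases "1 \<le> 2 * x")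
      case True
      have "x ^ m \<le> (2 * x) ^ (k - m) * x ^ m"
        using mult_right_mono[OF one_le_power[OF True], of "x ^ m"] assms(1) by simp
      also have "\<dots> = 2 ^ (k - m) * x ^ k"
        using m(1) by (simp add: power_mult_distrib flip: power_add)
      also have "\<dots> \<le> 2 ^ k * ?B"
        using assms term_le[of k] by (intro mult_mono power_increasing) auto
      finally show ?thesis by simp
    next
      case False
      then have "1 \<le> 2 * y"
        using assms(3) by simp
      have "x ^ m \<le> x ^ m * (2 * y) ^ (k - m)"
        using mult_left_mono[OF one_le_power[OF \<open>1 \<le> 2 * y\<close>], of "x ^ m"] assms(1) by simp
      also have "\<dots> = 2 ^ (k - m) * (x ^ m * y ^ (k - m))"
        by (simp add: power_mult_distrib)
      also have "\<dots> \<le> 2 ^ k * ?B"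
        using assms term_le[of m] m by (intro mult_mono power_increasing) auto
      finally show ?thesis by simp
    qed
    then have "val (of_nat (2 ^ k) * ?B) \<le> val (x ^ m)"
      using assms by (intro val_antimono) auto
    then show ?thesis
      by (subst (asm) val_of_nat_mult) auto
  qed
  ultimately show ?thesis
    by (simp add: val_power m_def)
qed

section \<open>Divisibility and piecewise linearity\<close>

lemma val_surj: "\<exists>c. c \<noteq> 0 \<and> val c = Fin g"
proof (induction g rule: value_group.abs_induct)
  case (1 c)
  then show ?case
    by (intro exI[of _ c]) (simp add: val_def value_eq_def)
qed

text \<open>For odd \<open>n\<close> the polynomial X^n - c has odd degree and hence a root; for
  even \<open>n\<close> a square root halves the exponent, and its absolute value keeps the radicand
  nonnegative.\<close>

lemma real_closed_root:
  fixes c :: "'a::linordered_field"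
  assumes "real_closed TYPE('a)" "0 < n" "0 \<le> c"
  shows "\<exists>y. y ^ n = c"
  using assms(2,3)
proof (induction n arbitrary: c rule: less_induct)
  case (less n)
  show ?case
  proof (cases "odd n")
    case True
    let ?p = "monom 1 n + [:- c:]"
    have "degree ?p = n"
      using less.prems by (subst degree_add_eq_left) (simp_all add: degree_monom_eq)
    with True assms(1) obtain x where "poly ?p x = 0"
      unfolding real_closed_def by metis
    then show ?thesis
      by (auto simp: poly_monom)
  next
    case False
    then obtain m where m: "n = m * 2"
      by (auto elim: evenE simp: mult.commute)
    obtain w where w: "w ^ 2 = c"
      using assms(1) less.prems(2) unfolding real_closed_def by blast
    obtain y where "y ^ m = \<bar>w\<bar>"
      using less.IH[of m "\<bar>w\<bar>"] m less.prems by auto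
    then have "y ^ n = c"
      using w by (simp add: m power_mult)
    then show ?thesis ..
  qed
qed

lemma value_group_divisible:
  fixes g :: "'a::ordered_valued_field value_group"
  assumes "real_closed TYPE('a)" "0 < n"
  shows "\<exists>z. zscale (int n) z = Fin g"
proof -
  obtain c :: 'a where c: "val c = Fin g"
    using val_surj by blast
  obtain y where "y ^ n = \<bar>c\<bar>"
    using real_closed_root[OF assms, of "\<bar>c\<bar>"] by auto
  then have "zscale (int n) (val y) = val c"
    by (simp add: abs_if flip: val_power split: if_splits)
  with c show ?thesis
    by auto
qed

section \<open>Arithmetic of integer multiples\<close>

lemma zscale_add: "zscale (int (m + n)) y = zscale (int m) y + zscale (int n) y"
  by (induction m) (simp_all add: zscale_Suc add.assoc del: of_nat_Suc of_nat_add)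

lemma zscale_mono: "y \<le> z \<Longrightarrow> zscale (int n) y \<le> zscale (int n) z"
  by (induction n) (simp_all add: zscale_Suc add_mono del: of_nat_Suc)

lemma zscale_minus: "zscale m (- y) = zscale (- m) y"
proof -
  have "((+) (- g) ^^ n) 0 = - ((+) g ^^ n) (0::'a)" for g n
    by (induction n) simp_all
  then show ?thesis
    by (cases y) auto
qed

lemma zscale_1 [simp]: "zscale 1 y = y"
  by (cases y) auto

lemma zscale_minus_1 [simp]: "zscale (-1) y = - y"
  by (simp flip: zscale_minus)

lemma extended_minus_minus [simp]: "- (- y) = (y :: 'g::group_add extended)"
  by (cases y) auto

lemma extended_minus_le_minus_iff [simp]:
  "- y \<le> - z \<longleftrightarrow> z \<le> (y :: 'g::linordered_ab_group_add extended)"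
  by (cases y; cases z) auto

text \<open>Unlike an explicit subdivision, this form of piecewise linearity lets one collect the
  breakpoints without sorting them.\<close>

definition affine_off ::
  "'g::linordered_ab_group_add extended set \<Rightarrow> ('g extended \<Rightarrow> 'g extended) \<Rightarrow> bool" where
  "affine_off B f \<longleftrightarrow>
     (\<forall>u v. (\<forall>z\<in>B. v \<le> z \<or> z \<le> u) \<longrightarrow> (\<exists>c m. \<forall>y\<in>{u..v}. f y = c + zscale m y))"

text \<open>The breakpoints are sorted after adjoining both infinities: no element of
  \<open>B\<close> lies strictly between neighbours, and the infinities make the intervals cover any
  \<open>S\<close>.\<close>

lemma affine_off_imp_piecewise_linear_on:
  assumes "finite B" "affine_off B f"
  shows "piecewise_linear_on S f"
proof -
  define A where "A = insert (-\<infinity>) (insert \<infinity> B)"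
  define xs where "xs = sorted_list_of_set A"
  have "finite A"
    using assms(1) by (simp add: A_def)
  then have xs: "set xs = A" "sorted xs"
    by (simp_all add: xs_def)
  then have "xs \<noteq> []"
    by (auto simp: A_def)
  have nth_in: "\<exists>l<length xs. xs ! l = z" if "z \<in> A" for z
    using that xs(1) by (metis in_set_conv_nth)
  let ?n = "length xs - 1"
  have ends: "xs ! 0 \<le> z" "z \<le> xs ! ?n" if "z \<in> A" for z
    using nth_in[OF that] sorted_nth_mono[OF xs(2)] by fastforce+
  have "S \<subseteq> {xs ! 0..xs ! ?n}"
    using ends(1)[of "-\<infinity>"] ends(2)[of "\<infinity>"] by (auto simp: A_def)
  moreover have "xs ! i \<le> xs ! Suc i" if "i < ?n" for i
    using that sorted_nth_mono[OF xs(2), of i "Suc i"] by simp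
  moreover have "\<exists>c m. \<forall>y\<in>S \<inter> {xs ! i..xs ! Suc i}. f y = c + zscale m y" if "i < ?n" for i
  proof -
    have "xs ! Suc i \<le> z \<or> z \<le> xs ! i" if z: "z \<in> B" for z
    proof -
      obtain l where "l < length xs" "xs ! l = z"
        using nth_in[of z] z by (auto simp: A_def)
      then show ?thesis
        using sorted_nth_mono[OF xs(2), of l i] sorted_nth_mono[OF xs(2), of "Suc i" l] \<open>i < ?n\<close>
        by (cases "l \<le> i") auto
    qed
    then have "\<exists>c m. \<forall>y\<in>{xs ! i..xs ! Suc i}. f y = c + zscale m y"
      using assms(2) unfolding affine_off_def by blast
    then show ?thesis
      by blast
  qed
  ultimately show ?thesis
    unfolding piecewise_linear_on_def by (intro exI[of _ ?n] exI[of _ "(!) xs"]) blast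
qed

text \<open>With 0 among the breakpoints an interval lies on one side of 0, where the truncation is
  constant or the identity.\<close>

lemma affine_off_max_0:
  assumes "affine_off B f"
  shows "affine_off (insert 0 B) (\<lambda>y. f (max y 0))"
  unfolding affine_off_def
proof (intro allI impI)
  fix u v assume uv: "\<forall>z\<in>insert 0 B. v \<le> z \<or> z \<le> u"
  show "\<exists>c m. \<forall>y\<in>{u..v}. f (max y 0) = c + zscale m y"
  proof (cases "v \<le> 0")
    case True
    then have "\<forall>y\<in>{u..v}. f (max y 0) = f 0 + zscale 0 y"
      by (auto simp: max_def intro!: arg_cong[of _ _ f])
    then show ?thesis by blast
  next
    case False
    with uv have "0 \<le> u" by auto
    obtain c m where "\<forall>y\<in>{u..v}. f y = c + zscale m y"
      using assms uv unfolding affine_off_def by blast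
    moreover have "max y 0 = y" if "y \<in> {u..v}" for y
      using that \<open>0 \<le> u\<close> by (intro max_absorb1) (auto intro: order_trans)
    ultimately have "\<forall>y\<in>{u..v}. f (max y 0) = c + zscale m y"
      by simp
    then show ?thesis by blast
  qed
qed

lemma affine_off_minus:
  assumes "affine_off B f"
  shows "affine_off (uminus ` B) (\<lambda>y. f (- y))"
  unfolding affine_off_def
proof (intro allI impI)
  fix u v assume "\<forall>z\<in>uminus ` B. v \<le> z \<or> z \<le> u"
  then have "\<forall>z\<in>B. - u \<le> z \<or> z \<le> - v"
    by (metis extended_minus_le_minus_iff extended_minus_minus imageI)
  then obtain c m where "\<forall>y\<in>{- v..- u}. f y = c + zscale m y"
    using assms unfolding affine_off_def by blast
  then have "\<forall>y\<in>{u..v}. f (- y) = c + zscale (- m) y"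
    by (simp flip: zscale_minus)
  then show "\<exists>c m. \<forall>y\<in>{u..v}. f (- y) = c + zscale m y"
    by blast
qed

text \<open>Divisibility is what puts the crossing point \<open>z\<close> of two lines into the group.\<close>

lemma lines_cross:
  fixes \<alpha> \<beta> :: "'g::linordered_ab_group_add extended"
  assumes div: "\<And>n (g :: 'g). 0 < n \<Longrightarrow> \<exists>z. zscale (int n) z = Fin g"
    and "\<alpha> \<noteq> -\<infinity>" "\<beta> \<noteq> -\<infinity>"
  shows "\<exists>z. \<forall>u v. v \<le> z \<or> z \<le> u \<longrightarrow>
     (\<forall>y\<in>{u..v}. \<alpha> + zscale (int p) y \<le> \<beta> + zscale (int q) y) \<or>
     (\<forall>y\<in>{u..v}. \<beta> + zscale (int q) y \<le> \<alpha> + zscale (int p) y)"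
proof -
  \<comment> \<open>Since \<open>\<infinity>\<close> absorbs even \<open>-\<infinity>\<close>, a
    line with infinite intercept is constantly infinite and any \<open>z\<close> will do.\<close>
  have inf: "\<infinity> + y = \<infinity>" "y + \<infinity> = \<infinity>" for y :: "'g extended"
    by (cases y; simp)+
  have *: "\<exists>z. \<forall>u v. v \<le> z \<or> z \<le> u \<longrightarrow>
     (\<forall>y\<in>{u..v}. \<alpha> + zscale (int p) y \<le> \<beta> + zscale (int q) y) \<or>
     (\<forall>y\<in>{u..v}. \<beta> + zscale (int q) y \<le> \<alpha> + zscale (int p) y)"
    if "p \<le> q" "\<alpha> \<noteq> -\<infinity>" "\<beta> \<noteq> -\<infinity>" for p q and \<alpha> \<beta> :: "'g extended"
  proof (cases "\<alpha> = \<infinity> \<or> \<beta> = \<infinity>")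
    case True
    then show ?thesis
      by (auto simp: inf)
  next
    case False
    with that obtain g h where gh: "\<alpha> = Fin g" "\<beta> = Fin h"
      by (cases \<alpha>; cases \<beta>) auto
    show ?thesis
    proof (cases "p = q")
      case True
      then show ?thesis
        using linear[of \<alpha> \<beta>] by (auto intro: add_right_mono)
    next
      case False
      then obtain n where n: "q = n + p" "0 < n"
        using \<open>p \<le> q\<close> by (metis le_add_diff_inverse2 nat_less_le zero_less_diff)
      \<comment> \<open>The slopes differ by \<open>n\<close>, so the lines meet where
        \<open>n\<close> times \<open>z\<close> is the difference of the intercepts.\<close>
      then obtain z where "zscale (int n) z = Fin (g - h)"
        using div by blast
      then have \<alpha>: "\<alpha> = \<beta> + zscale (int n) z"
        by (simp add: gh)
      have \<beta>: "\<beta> + zscale (int q) y = \<beta> + zscale (int n) y + zscale (int p) y" for y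
        unfolding n zscale_add by (simp add: add.assoc)
      have "\<beta> + zscale (int q) y \<le> \<alpha> + zscale (int p) y" if "y \<le> z" for y
        unfolding \<alpha> \<beta> using that by (intro add_right_mono add_left_mono zscale_mono)
      moreover have "\<alpha> + zscale (int p) y \<le> \<beta> + zscale (int q) y" if "z \<le> y" for y
        unfolding \<alpha> \<beta> using that by (intro add_right_mono add_left_mono zscale_mono)
      ultimately show ?thesis
        by (intro exI[of _ z]) (meson atLeastAtMost_iff order_trans)
    qed
  qed
  show ?thesis
  proof (cases "p \<le> q")
    case True
    then show ?thesis
      using * assms by blast
  next
    case False
    then have "q \<le> p" by simp
    from *[OF this assms(3,2)] show ?thesis
      by meson
  qed
qed

text \<open>Comparison on all of \<open>Y\<close> is a total preorder on the functions, so a finite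
  family has a member that is least everywhere.\<close>

lemma ex_uniform_min:
  fixes \<phi> :: "'i \<Rightarrow> 'y \<Rightarrow> 'b::linorder"
  assumes "finite J" "J \<noteq> {}"
    and "\<And>i j. i \<in> J \<Longrightarrow> j \<in> J \<Longrightarrow> (\<forall>y\<in>Y. \<phi> i y \<le> \<phi> j y) \<or> (\<forall>y\<in>Y. \<phi> j y \<le> \<phi> i y)"
  shows "\<exists>i\<in>J. \<forall>j\<in>J. \<forall>y\<in>Y. \<phi> i y \<le> \<phi> j y"
  using assms
proof (induction rule: finite_ne_induct)
  case (insert x J)
  then obtain i where i: "i \<in> J" "\<forall>j\<in>J. \<forall>y\<in>Y. \<phi> i y \<le> \<phi> j y"
    by auto
  have "(\<forall>y\<in>Y. \<phi> x y \<le> \<phi> i y) \<or> (\<forall>y\<in>Y. \<phi> i y \<le> \<phi> x y)"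
    using insert.prems[of x i] i(1) by simp
  then show ?case
  proof
    assume "\<forall>y\<in>Y. \<phi> x y \<le> \<phi> i y"
    with i(2) show ?thesis
      by (intro bexI[of _ x]) (auto intro: order_trans)
  qed (use i in auto)
qed auto

text \<open>The crossing points of all pairs of lines serve as breakpoints: between them the order
  of the lines does not change and a single line realises the minimum.\<close>

lemma ex_affine_off_Min:
  fixes \<alpha> :: "'i \<Rightarrow> 'g::linordered_ab_group_add extended"
  assumes div: "\<And>n (g :: 'g). 0 < n \<Longrightarrow> \<exists>z. zscale (int n) z = Fin g"
    and "finite J" "J \<noteq> {}" "\<And>j. j \<in> J \<Longrightarrow> \<alpha> j \<noteq> -\<infinity>"
  shows "\<exists>B. finite B \<and> affine_off B (\<lambda>y. Min ((\<lambda>j. \<alpha> j + zscale (int (k j)) y) ` J))"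
proof -
  let ?l = "\<lambda>j y. \<alpha> j + zscale (int (k j)) y"
  have "\<exists>z. \<forall>u v. v \<le> z \<or> z \<le> u \<longrightarrow> (\<forall>y\<in>{u..v}. ?l i y \<le> ?l j y) \<or> (\<forall>y\<in>{u..v}. ?l j y \<le> ?l i y)"
    if "i \<in> J" "j \<in> J" for i j
    using that by (intro lines_cross div assms(4))
  then obtain z where z: "\<And>i j u v. i \<in> J \<Longrightarrow> j \<in> J \<Longrightarrow> v \<le> z i j \<or> z i j \<le> u \<Longrightarrow>
      (\<forall>y\<in>{u..v}. ?l i y \<le> ?l j y) \<or> (\<forall>y\<in>{u..v}. ?l j y \<le> ?l i y)"
    by metis
  define B where "B = (\<lambda>(i, j). z i j) ` (J \<times> J)"
  have "affine_off B (\<lambda>y. Min ((\<lambda>j. ?l j y) ` J))"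
    unfolding affine_off_def
  proof (intro allI impI)
    fix u v assume uv: "\<forall>z\<in>B. v \<le> z \<or> z \<le> u"
    have "(\<forall>y\<in>{u..v}. ?l i y \<le> ?l j y) \<or> (\<forall>y\<in>{u..v}. ?l j y \<le> ?l i y)"
      if "i \<in> J" "j \<in> J" for i j
      using that uv by (intro z) (auto simp: B_def)
    then obtain i where "i \<in> J" "\<forall>j\<in>J. \<forall>y\<in>{u..v}. ?l i y \<le> ?l j y"
      using ex_uniform_min[of J "{u..v}" ?l] assms(2,3) by blast
    then have "\<forall>y\<in>{u..v}. Min ((\<lambda>j. ?l j y) ` J) = ?l i y"
      using assms(2) by (auto intro!: Min_eqI)
    then show "\<exists>c m. \<forall>y\<in>{u..v}. Min ((\<lambda>j. ?l j y) ` J) = c + zscale m y"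
      by blast
  qed
  moreover have "finite B"
    using assms(2) by (simp add: B_def)
  ultimately show ?thesis
    by blast
qed

lemma min_formula_eq_Min:
  "min_formula d \<nu> \<delta> k y
     = Min ((\<lambda>j. (if j = 0 then \<nu> 0 else \<nu> j + zscale (int j) \<delta>)
                  + zscale (int (if j = 0 then 0 else k j)) y) ` {..d})"
proof -
  have "{..d} = insert 0 {1..d}"
    by auto
  then show ?thesis
    unfolding min_formula_def by (auto intro!: arg_cong[of _ _ Min] image_cong simp: image_iff)
qed

lemma min_formula_mono:
  assumes "y \<le> z"
  shows "min_formula d \<nu> \<delta> k y \<le> min_formula d \<nu> \<delta> k z"
  unfolding min_formula_eq_Min
proof (rule Min.boundedI)
  fix w assume "w \<in> (\<lambda>j. (if j = 0 then \<nu> 0 else \<nu> j + zscale (int j) \<delta>)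
                  + zscale (int (if j = 0 then 0 else k j)) z) ` {..d}"
  then obtain j where j: "j \<le> d" "w = (if j = 0 then \<nu> 0 else \<nu> j + zscale (int j) \<delta>)
                  + zscale (int (if j = 0 then 0 else k j)) z"
    by auto
  have "(if j = 0 then \<nu> 0 else \<nu> j + zscale (int j) \<delta>) + zscale (int (if j = 0 then 0 else k j)) y \<le> w"
    unfolding j(2) using assms by (intro add_left_mono zscale_mono)
  then show "Min ((\<lambda>j. (if j = 0 then \<nu> 0 else \<nu> j + zscale (int j) \<delta>)
                  + zscale (int (if j = 0 then 0 else k j)) y) ` {..d}) \<le> w"
    using j(1) by (intro Min.coboundedI[THEN order_trans]) auto
qed auto

text \<open>A finite \<delta> keeps the intercepts away from \<open>-\<infinity>\<close>, as
  \<open>lines_cross\<close> requires, while values \<open>\<nu> j\<close> equal to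
  \<open>\<infinity>\<close> are allowed.\<close>

lemma ex_affine_off_min_formula:
  fixes \<nu> :: "nat \<Rightarrow> 'a::ordered_valued_field value_group extended"
  assumes "real_closed TYPE('a)" "\<And>j. j \<le> d \<Longrightarrow> \<nu> j \<noteq> -\<infinity>" "\<delta> \<noteq> \<infinity>" "\<delta> \<noteq> -\<infinity>"
  shows "\<exists>B. finite B \<and> affine_off B (min_formula d \<nu> \<delta> k)"
proof -
  have "\<nu> j + zscale (int j) \<delta> \<noteq> -\<infinity>" if "j \<le> d" for j
    using assms(2)[OF that] assms(3,4) by (cases "\<nu> j"; cases \<delta>) auto
  then show ?thesis
    unfolding min_formula_eq_Min
    using assms(2) by (intro ex_affine_off_Min value_group_divisible assms(1)) auto
qed

section \<open>The valuation of a polynomial on an interval\<close>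

text \<open>Reading the coefficients backwards for \<open>\<epsilon> 1 = -1\<close> gives both cases
  one description, the least exponent with \<open>c i \<noteq> 0\<close>. The lower bound 1 comes
  from \<open>c 0 = 0\<close>, the upper bound from \<open>c j \<noteq> 0\<close>.\<close>

lemma
  assumes "\<forall>i\<le>d. \<epsilon> i = 1 \<or> \<epsilon> i = -1" "\<epsilon> 0 = 1" "j \<in> {1..d}"
  shows gtf_exponent_bounds: "1 \<le> gtf_exponent d \<epsilon> j \<and> gtf_exponent d \<epsilon> j \<le> j"
    and val_gtf_form: "\<And>x y :: 'a::ordered_valued_field. 0 \<le> x \<Longrightarrow> 0 \<le> y \<Longrightarrow> x + y = 1 \<Longrightarrow>
      val (binary_form (gtf_coeff (keeps_left d \<epsilon>) j) j x y)
        = zscale (int (gtf_exponent d \<epsilon> j)) (if \<epsilon> 1 = 1 then val x else val y)"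
proof -
  define s where "s = keeps_left d \<epsilon>"
  define c where "c = (if \<epsilon> 1 = 1 then gtf_coeff s j else (\<lambda>i. gtf_coeff s j (j - i)))"
  have \<epsilon>1: "\<epsilon> 1 = 1 \<or> \<epsilon> 1 = -1"
    by (rule assms(1)[rule_format]) (use assms(3) in simp)
  have s0: "s 0 \<longleftrightarrow> \<epsilon> 1 = 1"
    using \<epsilon>1 assms(2,3) by (elim disjE) (simp_all add: s_def keeps_left_def)
  have "(if \<epsilon> 1 = 1 then gtf d \<epsilon> j i else gtf d \<epsilon> j (j - i)) = c i" if "i \<le> j" for i
    using assms that by (simp add: gtf_eq c_def s_def)
  then have exponent: "gtf_exponent d \<epsilon> j = (LEAST i. i \<le> j \<and> c i \<noteq> 0)"
    unfolding gtf_exponent_def by (auto intro!: arg_cong[of _ _ Least])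
  have c: "c 0 = 0" "c j \<noteq> 0"
    using assms zigzag_eq_0[of j s] zigzag_pos[of j s] s0 by (auto simp: c_def gtf_coeff_def)
  have "gtf_exponent d \<epsilon> j \<le> j \<and> c (gtf_exponent d \<epsilon> j) \<noteq> 0"
    unfolding exponent by (rule LeastI[of _ j]) (simp add: c)
  with c(1) show "1 \<le> gtf_exponent d \<epsilon> j \<and> gtf_exponent d \<epsilon> j \<le> j"
    by (metis less_one not_le)
  show "val (binary_form (gtf_coeff (keeps_left d \<epsilon>) j) j x y)
        = zscale (int (gtf_exponent d \<epsilon> j)) (if \<epsilon> 1 = 1 then val x else val y)"
    if "0 \<le> x" "0 \<le> y" "x + y = 1" for x y :: 'a
  proof (cases "\<epsilon> 1 = 1")
    case True
    then show ?thesis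
      using val_binary_form[of x y c j] that c(2) unfolding exponent by (simp add: c_def s_def)
  next
    case False
    then show ?thesis
      using val_binary_form[of y x c j] that c(2) unfolding exponent
      by (subst binary_form_commute) (simp add: c_def s_def add.commute)
  qed
qed

lemma sign_mult: "x = 1 \<or> x = -1 \<Longrightarrow> y = 1 \<or> y = -1 \<Longrightarrow> x * y = 1 \<or> x * y = (-1 :: int)"
  by auto

text \<open>As \<open>\<sigma> 0 * \<epsilon> k = \<sigma> k\<close>, multiplying the Taylor formula
  by \<open>\<sigma> 0\<close> makes all its terms nonnegative, so the value of the sum is the
  minimum of the values of the terms.\<close>

lemma val_poly_eq_min_formula:
  fixes P :: "'a::ordered_valued_field poly"
  defines "d \<equiv> degree P"
  assumes "a < b" "x \<in> {a..b}"
    and \<sigma>: "\<forall>k\<le>d. \<sigma> k = 1 \<or> \<sigma> k = (-1::int)"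
    and nonneg: "\<forall>k\<le>d. \<forall>z\<in>{a..b}. 0 \<le> of_int (\<sigma> k) * poly (divided_deriv k P) z"
  defines "\<epsilon> \<equiv> \<lambda>i. \<sigma> 0 * \<sigma> i"
  shows "val (poly P x) = min_formula d (\<lambda>k. val (poly (divided_deriv k P) (gtf_node d \<epsilon> a b k)))
    (val (b - a)) (gtf_exponent d \<epsilon>)
    (if \<epsilon> 1 = 1 then val ((x - a) / (b - a)) else val (1 - (x - a) / (b - a)))"
    (is "_ = min_formula _ ?\<nu> ?\<delta> ?k ?y")
proof -
  let ?N = "gtf_node d \<epsilon> a b"
  let ?D = "\<lambda>k. poly (divided_deriv k P)"
  define t where "t = (x - a) / (b - a)"
  define H where "H = (\<lambda>k. binary_form (gtf_coeff (keeps_left d \<epsilon>) k) k (x - a) (b - x))"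
  have \<sigma>0: "\<sigma> 0 = 1 \<or> \<sigma> 0 = -1"
    using \<sigma> by simp
  have \<epsilon>: "\<forall>i\<le>d. \<epsilon> i = 1 \<or> \<epsilon> i = -1" "\<epsilon> 0 = 1"
    unfolding \<epsilon>_def using sign_mult[of "\<sigma> 0"] \<sigma> \<sigma>0 by (blast, elim disjE, simp_all)
  have t: "0 \<le> t" "0 \<le> 1 - t"
    using assms(2,3) by (auto simp: t_def)
  \<comment> \<open>By homogeneity the factor \<open>b - a\<close> comes out of each form as a power
    and contributes the multiple of \<open>?\<delta>\<close>; the arguments \<open>t\<close> and
    \<open>1 - t\<close> that remain add up to 1, as \<open>val_gtf_form\<close> requires.\<close>
  have xt: "x - a = (b - a) * t" "b - x = (b - a) * (1 - t)"
    using assms(2) by (simp_all add: t_def field_simps)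
  have N: "?N k \<in> {a..b}" for k
    using assms(2) by (auto simp: gtf_node_def)
  define T where "T = (\<lambda>k. if k = 0 then of_int (\<sigma> 0) * poly P (?N 0) else H k * (of_int (\<sigma> k) * ?D k (?N k)))"
  have "of_int (\<sigma> 0) * poly P x = of_int (\<sigma> 0) * poly P (?N 0)
      + (\<Sum>k=1..d. of_int (\<sigma> 0 * \<epsilon> k) * (H k * ?D k (?N k)))"
    by (subst gtf_Taylor[OF \<epsilon>, of P x a b])
      (simp_all add: d_def H_def distrib_left sum_distrib_left mult_ac)
  also have "(\<Sum>k=1..d. of_int (\<sigma> 0 * \<epsilon> k) * (H k * ?D k (?N k))) = (\<Sum>k=1..d. T k)"
    using \<sigma>0 by (intro sum.cong refl) (auto simp: \<epsilon>_def T_def)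
  also have "of_int (\<sigma> 0) * poly P (?N 0) = T 0"
    by (simp add: T_def)
  also have "T 0 + (\<Sum>k=1..d. T k) = (\<Sum>k\<in>insert 0 {1..d}. T k)"
    by simp
  finally have "val (of_int (\<sigma> 0) * poly P x) = val (\<Sum>k\<in>insert 0 {1..d}. T k)"
    by simp
  also have "\<dots> = Min ((\<lambda>k. val (T k)) ` insert 0 {1..d})"
  proof (rule val_sum_nonneg)
    fix k assume k: "k \<in> insert 0 {1..d}"
    then have "0 \<le> of_int (\<sigma> k) * ?D k (?N k)"
      using nonneg N by auto
    moreover have "0 \<le> H k"
      unfolding H_def using assms(3) by (intro binary_form_nonneg) auto
    ultimately show "0 \<le> T k"
      by (auto simp: T_def)
  qed auto
  also have "\<dots> = min_formula d ?\<nu> ?\<delta> ?k ?y"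
  proof -
    have sgn: "val (of_int (\<sigma> k) * z) = val z" if "k \<le> d" for k z
      using \<sigma> that by fastforce
    have "val (T k) = ?\<nu> k + zscale (int k) ?\<delta> + zscale (int (?k k)) ?y" if k: "k \<in> {1..d}" for k
    proof -
      have "val (H k) = zscale (int k) ?\<delta> + zscale (int (?k k)) ?y"
        unfolding H_def xt binary_form_mult val_mult val_power
        using val_gtf_form[OF \<epsilon> k t] by (simp add: t_def)
      then show ?thesis
        using k by (auto simp: T_def val_mult sgn[unfolded val_mult] add_ac)
    qed
    moreover have "val (T 0) = ?\<nu> 0"
      by (simp add: T_def sgn)
    ultimately show ?thesis
      unfolding min_formula_def image_insert by (auto intro!: arg_cong[of _ _ Min])
  qed
  also have "val (of_int (\<sigma> 0) * poly P x) = val (poly P x)"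
    using \<sigma>0 by auto
  finally show ?thesis .
qed

section \<open>Passage along the embedding into the real closure\<close>

lemma ordered_field_homD:
  assumes "ordered_field_hom h"
  shows "h 0 = 0" "h 1 = 1" "h (x + y) = h x + h y" "h (x * y) = h x * h y" "h (of_nat n) = of_nat n"
    "h x = 0 \<longleftrightarrow> x = 0"
proof -
  have h: "h 1 = 1" "\<And>x y. h (x + y) = h x + h y" "\<And>x y. h (x * y) = h x * h y"
    using assms by (auto simp: ordered_field_hom_def)
  then show "h 1 = 1" "h (x + y) = h x + h y" "h (x * y) = h x * h y"
    by auto
  show h0: "h 0 = 0"
    using h(2)[of 0 0] by simp
  show "h (of_nat n) = of_nat n"
    by (induction n) (simp_all add: h h0)
  show "h x = 0 \<longleftrightarrow> x = 0"
    using h(1) h(3)[of x "inverse x"] h0 by (cases "x = 0") auto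
qed

text \<open>The factorial divides out and leaves an integer binomial factor, which a homomorphism
  preserves.\<close>

lemma coeff_divided_deriv: "coeff (divided_deriv k P) n = of_nat ((n + k) choose k) * coeff P (n + k)"
proof -
  have "of_nat ((n + k) choose k) = (pochhammer (of_nat (Suc n)) k / fact k :: 'a)"
    by (simp add: binomial_gbinomial gbinomial_pochhammer' algebra_simps)
  then show ?thesis
    by (simp add: divided_deriv_def coeff_higher_pderiv)
qed

lemma map_poly_divided_deriv:
  assumes "ordered_field_hom h"
  shows "map_poly h (divided_deriv k P) = divided_deriv k (map_poly h P)"
  by (rule poly_eqI) (simp add: coeff_map_poly coeff_divided_deriv ordered_field_homD[OF assms])

lemma val_divide: "y \<noteq> 0 \<Longrightarrow> val (x / y) = val x - val y"
  using val_mult[of "x / y" y] by (cases "x = 0") (auto simp: val_def)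

text \<open>One of the two values is 0 and the other nonnegative, possibly infinite, so their
  difference determines both.\<close>

lemma extended_max_diff:
  fixes u w :: "'g::linordered_ab_group_add extended"
  assumes "min u w = 0"
  shows "max (u - w) 0 = u" "max (- (u - w)) 0 = w"
  using assms by (cases u; cases w; auto simp: zero_extended_def min_def max_def split: if_splits)+

theorem theorem1p3p6:
  fixes h :: "'k::ordered_valued_field \<Rightarrow> 'r::ordered_valued_field"
    and P :: "'k poly" and a b :: 'r
  defines "d \<equiv> degree P"
  defines "Q \<equiv> \<lambda>k x. poly (map_poly h (divided_deriv k P)) x"
  defines "\<sigma> \<equiv> \<lambda>i. sign_on {a<..<b} (Q i)"
  defines "\<epsilon> \<equiv> \<lambda>i. \<sigma> 0 * \<sigma> i"
  defines "\<nu> \<equiv> \<lambda>k. val (Q k (gtf_node d \<epsilon> a b k))"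
  defines "\<delta> \<equiv> val (b - a)"
  defines "t\<^sub>1 \<equiv> \<lambda>x. (x - a) / (b - a)"
  defines "t\<^sub>2 \<equiv> \<lambda>x. 1 - t\<^sub>1 x"
  defines "\<tau>\<^sub>1 \<equiv> \<lambda>x. val (t\<^sub>1 x)"
  defines "\<tau>\<^sub>2 \<equiv> \<lambda>x. val (t\<^sub>2 x)"
  defines "\<tau> \<equiv> \<lambda>x. \<tau>\<^sub>1 x - \<tau>\<^sub>2 x"
  defines "k \<equiv> gtf_exponent d \<epsilon>"
  assumes "is_real_closure h"
    and "P \<noteq> 0"
    and "a < b"
    and "\<forall>k\<le>d. 0 \<le> Q k a * Q k b"
  shows
    \<comment> \<open>the signs are well defined\<close>
    "(\<forall>i\<le>d. (\<sigma> i = 1 \<or> \<sigma> i = -1) \<and> (\<forall>x\<in>{a<..<b}. sgn (Q i x) = of_int (\<sigma> i))) \<and>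
     \<comment> \<open>monotonicity with respect to \<open>t\<^sub>1\<close>\<close>
     (mono_on {0..1} (\<lambda>t. val (Q 0 (a + t * (b - a)))) \<or>
      antimono_on {0..1} (\<lambda>t. val (Q 0 (a + t * (b - a))))) \<and>
     \<comment> \<open>bounds on the extracted integers; in particular \<open>k 1 = 1\<close>\<close>
     (\<forall>j\<in>{1..d}. 1 \<le> k j \<and> k j \<le> j) \<and>
     \<comment> \<open>(a)\<close>
     (\<epsilon> 1 = 1 \<longrightarrow> (\<forall>x\<in>{a..b}. val (Q 0 x) = min_formula d \<nu> \<delta> k (\<tau>\<^sub>1 x))) \<and>
     (\<epsilon> 1 = -1 \<longrightarrow> (\<forall>x\<in>{a..b}. val (Q 0 x) = min_formula d \<nu> \<delta> k (\<tau>\<^sub>2 x))) \<and>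
     \<comment> \<open>(b)\<close>
     (val (Q 0 a) = val (Q 0 b) \<longrightarrow> (\<forall>x\<in>{a..b}. val (Q 0 x) = val (Q 0 a))) \<and>
     (val (Q 0 a) > val (Q 0 b) \<longrightarrow>
        increasing_pl_wrt {a..b} (\<lambda>x. val ((x - a) / (b - a))) (\<lambda>x. val (Q 0 x))) \<and>
     (val (Q 0 a) < val (Q 0 b) \<longrightarrow>
        increasing_pl_wrt {a..b} (\<lambda>x. val ((b - x) / (b - a))) (\<lambda>x. val (Q 0 x))) \<and>
     \<comment> \<open>(c)\<close>
     (\<forall>x\<in>{a..<b}. \<tau> x = val (t\<^sub>1 x / (1 - t\<^sub>1 x))) \<and> \<tau> a = \<infinity> \<and> \<tau> b = -\<infinity> \<and>
     (\<forall>x\<in>{a..b}. \<tau>\<^sub>1 x = max (\<tau> x) 0 \<and> \<tau>\<^sub>2 x = max (- \<tau> x) 0) \<and>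
     monotone_pl_wrt {a..b} \<tau> (\<lambda>x. val (Q 0 x)) \<and>
     (\<forall>x\<in>{a..b}. val (Q 0 x) = min_formula d \<nu> \<delta> k (max (zscale (\<epsilon> 1) (\<tau> x)) 0))"
proof -
  define R where "R = map_poly h P"
  have hom: "ordered_field_hom h" and rc: "real_closed TYPE('r)"
    using assms(13) by (auto simp: is_real_closure_def)
  have Q: "Q i = poly (divided_deriv i R)" for i
    by (simp add: Q_def R_def map_poly_divided_deriv[OF hom])
  have d: "d = degree R"
    by (simp add: d_def R_def degree_map_poly ordered_field_homD(6)[OF hom])
  have "R \<noteq> 0"
    using assms(14) by (auto simp: R_def poly_eq_iff coeff_map_poly ordered_field_homD[OF hom])
  obtain \<sigma>' :: "nat \<Rightarrow> int" where \<sigma>': "\<forall>i\<le>d. (\<sigma>' i = 1 \<or> \<sigma>' i = -1)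
     \<and> (\<forall>x\<in>{a..b}. 0 \<le> of_int (\<sigma>' i) * Q i x) \<and> (\<forall>x\<in>{a<..<b}. 0 < of_int (\<sigma>' i) * Q i x)"
    using constant_signs[OF \<open>R \<noteq> 0\<close> \<open>a < b\<close>] assms(16) unfolding Q d by blast
  have sgn_Q: "sgn (Q i x) = of_int (\<sigma>' i)" if "i \<le> d" "x \<in> {a<..<b}" for i x
  proof -
    have "\<sigma>' i = 1 \<or> \<sigma>' i = -1" "0 < of_int (\<sigma>' i) * Q i x"
      using \<sigma>' that by blast+
    then show ?thesis by (auto simp: sgn_if)
  qed
  \<comment> \<open>A point of the open interval makes the sign in \<open>sign_on\<close>
    unique.\<close>
  obtain mid where "mid \<in> {a<..<b}"
    using dense[OF \<open>a < b\<close>] by auto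
  then have \<sigma>_eq: "\<sigma> i = \<sigma>' i" if "i \<le> d" for i
    unfolding \<sigma>_def using \<sigma>' sgn_Q that by (intro sign_on_eqI) auto
  have \<sigma>: "\<forall>i\<le>d. \<sigma> i = 1 \<or> \<sigma> i = -1" "\<forall>i\<le>d. \<forall>x\<in>{a..b}. 0 \<le> of_int (\<sigma> i) * Q i x"
    using \<sigma>' \<sigma>_eq by auto
  have \<sigma>0: "\<sigma> 0 = 1 \<or> \<sigma> 0 = -1"
    using \<sigma>(1) by simp
  have \<epsilon>: "\<forall>i\<le>d. \<epsilon> i = 1 \<or> \<epsilon> i = -1" "\<epsilon> 0 = 1"
    unfolding \<epsilon>_def using sign_mult[of "\<sigma> 0"] \<sigma>(1) \<sigma>0 by (blast, elim disjE, simp_all)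
  define F where "F = (\<lambda>x. val (Q 0 x))"
  define M where "M = min_formula d \<nu> \<delta> k"
  have F: "F x = M (if \<epsilon> 1 = 1 then \<tau>\<^sub>1 x else \<tau>\<^sub>2 x)" if "x \<in> {a..b}" for x
    using val_poly_eq_min_formula[OF \<open>a < b\<close> that, of R \<sigma>] \<sigma> Q
    unfolding F_def M_def \<nu>_def \<delta>_def k_def \<tau>\<^sub>1_def \<tau>\<^sub>2_def t\<^sub>1_def t\<^sub>2_def d Q \<epsilon>_def by simp
  have M_mono: "M y \<le> M z" if "y \<le> z" for y z
    unfolding M_def using that by (rule min_formula_mono)
  obtain B where B: "finite B" "affine_off B M"
    using ex_affine_off_min_formula[OF rc, of d \<nu> \<delta> k] \<open>a < b\<close> unfolding M_def \<nu>_def \<delta>_def by auto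
  have t_ge0: "0 \<le> t\<^sub>1 x" "0 \<le> t\<^sub>2 x" if "x \<in> {a..b}" for x
    using that \<open>a < b\<close> by (auto simp: t\<^sub>1_def t\<^sub>2_def)
  have t_mono: "t\<^sub>1 x \<le> t\<^sub>1 y" "t\<^sub>2 y \<le> t\<^sub>2 x" if "x \<le> y" for x y
    using that \<open>a < b\<close> by (auto simp: t\<^sub>1_def t\<^sub>2_def divide_right_mono)
  \<comment> \<open>As x moves to the right \<open>t\<^sub>1\<close> grows and its value falls; in
    the other case the formula depends on \<open>t\<^sub>2\<close>, which shrinks.\<close>
  have F_antimono: "F y \<le> F x" if "\<epsilon> 1 = 1" "x \<in> {a..b}" "y \<in> {a..b}" "x \<le> y" for x y
    using that t_ge0 t_mono by (auto simp: F \<tau>\<^sub>1_def intro!: M_mono val_antimono)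
  have F_mono: "F x \<le> F y" if "\<epsilon> 1 \<noteq> 1" "x \<in> {a..b}" "y \<in> {a..b}" "x \<le> y" for x y
    using that t_ge0 t_mono by (auto simp: F \<tau>\<^sub>2_def intro!: M_mono val_antimono)
  have ab: "a \<in> {a..b}" "b \<in> {a..b}"
    using \<open>a < b\<close> by auto
  \<comment> \<open>The parameters \<open>t\<^sub>1 x\<close> and \<open>t\<^sub>2 x\<close> are
    nonnegative with sum 1, so the smaller of their values is the value of 1.\<close>
  have min_\<tau>: "min (\<tau>\<^sub>1 x) (\<tau>\<^sub>2 x) = 0" if "x \<in> {a..b}" for x
    using val_add_nonneg[OF t_ge0[OF that]] by (simp add: \<tau>\<^sub>1_def \<tau>\<^sub>2_def t\<^sub>2_def)
  have \<tau>: "max (\<tau> x) 0 = \<tau>\<^sub>1 x" "max (- \<tau> x) 0 = \<tau>\<^sub>2 x" if "x \<in> {a..b}" for x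
    using extended_max_diff[OF min_\<tau>[OF that]] by (simp_all add: \<tau>_def)

  have 1: "\<forall>i\<le>d. (\<sigma> i = 1 \<or> \<sigma> i = -1) \<and> (\<forall>x\<in>{a<..<b}. sgn (Q i x) = of_int (\<sigma> i))"
    using \<sigma>(1) sgn_Q \<sigma>_eq by auto
  have 2: "mono_on {0..1} (\<lambda>t. val (Q 0 (a + t * (b - a)))) \<or>
      antimono_on {0..1} (\<lambda>t. val (Q 0 (a + t * (b - a))))"
  proof -
    have in_ab: "a + t * (b - a) \<in> {a..b}" if "t \<in> {0..1}" for t
    proof -
      have "t * (b - a) \<le> 1 * (b - a)"
        using that \<open>a < b\<close> by (intro mult_right_mono) auto
      moreover have "0 \<le> t * (b - a)"
        using that \<open>a < b\<close> by simp
      ultimately show ?thesis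
        unfolding atLeastAtMost_iff by (intro conjI) (simp, simp only: mult_1 le_diff_eq add.commute)
    qed
    have le: "a + t * (b - a) \<le> a + u * (b - a)" if "t \<le> u" for t u
      using that \<open>a < b\<close> by (simp add: mult_right_mono)
    show ?thesis
    proof (cases "\<epsilon> 1 = 1")
      case True
      then have "antimono_on {0..1} (\<lambda>t. val (Q 0 (a + t * (b - a))))"
        using F_antimono in_ab le unfolding F_def by (intro monotone_onI) blast
      then show ?thesis ..
    next
      case False
      then have "mono_on {0..1} (\<lambda>t. val (Q 0 (a + t * (b - a))))"
        using F_mono in_ab le unfolding F_def by (intro monotone_onI) blast
      then show ?thesis ..
    qed
  qed
  have 3: "\<forall>j\<in>{1..d}. 1 \<le> k j \<and> k j \<le> j"
    unfolding k_def using gtf_exponent_bounds[OF \<epsilon>] by blast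
  have 4: "\<epsilon> 1 = 1 \<longrightarrow> (\<forall>x\<in>{a..b}. F x = M (\<tau>\<^sub>1 x))"
    "\<epsilon> 1 = -1 \<longrightarrow> (\<forall>x\<in>{a..b}. F x = M (\<tau>\<^sub>2 x))"
    by (simp_all add: F)
  have 5: "F a = F b \<longrightarrow> (\<forall>x\<in>{a..b}. F x = F a)"
  proof (intro impI ballI antisym)
    fix x assume *: "F a = F b" "x \<in> {a..b}"
    show "F x \<le> F a"
      using F_antimono[of a x] F_mono[of x b] * ab by (cases "\<epsilon> 1 = 1") auto
    show "F a \<le> F x"
      using F_antimono[of x b] F_mono[of a x] * ab by (cases "\<epsilon> 1 = 1") auto
  qed
  have increasing: "increasing_pl_wrt {a..b} t F" if "\<And>x. x \<in> {a..b} \<Longrightarrow> F x = M (t x)" for t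
    unfolding increasing_pl_wrt_def
    using that M_mono affine_off_imp_piecewise_linear_on[OF B]
    by (intro exI[of _ M] conjI ballI monotone_onI) auto
  have 6: "F a > F b \<longrightarrow> increasing_pl_wrt {a..b} (\<lambda>x. val ((x - a) / (b - a))) F"
  proof
    assume "F b < F a"
    \<comment> \<open>A strict drop from \<open>a\<close> to \<open>b\<close> excludes the case in
      which \<open>F\<close> increases.\<close>
    then have "\<epsilon> 1 = 1"
      using F_mono[of a b] ab \<open>a < b\<close> by force
    then show "increasing_pl_wrt {a..b} (\<lambda>x. val ((x - a) / (b - a))) F"
      by (intro increasing) (simp add: F \<tau>\<^sub>1_def t\<^sub>1_def)
  qed
  have 7: "F a < F b \<longrightarrow> increasing_pl_wrt {a..b} (\<lambda>x. val ((b - x) / (b - a))) F"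
  proof
    assume "F a < F b"
    then have "\<epsilon> 1 \<noteq> 1"
      using F_antimono[of a b] ab \<open>a < b\<close> by force
    moreover have "(b - x) / (b - a) = t\<^sub>2 x" for x
      using \<open>a < b\<close> by (simp add: t\<^sub>2_def t\<^sub>1_def field_simps)
    ultimately show "increasing_pl_wrt {a..b} (\<lambda>x. val ((b - x) / (b - a))) F"
      by (intro increasing) (simp add: F \<tau>\<^sub>2_def)
  qed
  have 8: "\<forall>x\<in>{a..<b}. \<tau> x = val (t\<^sub>1 x / (1 - t\<^sub>1 x))"
  proof
    fix x assume "x \<in> {a..<b}"
    then have "1 - t\<^sub>1 x \<noteq> 0"
      by (simp add: t\<^sub>1_def)
    then show "\<tau> x = val (t\<^sub>1 x / (1 - t\<^sub>1 x))"
      by (simp add: val_divide \<tau>_def \<tau>\<^sub>1_def \<tau>\<^sub>2_def t\<^sub>2_def)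
  qed
  have 9: "\<tau> a = \<infinity>" "\<tau> b = -\<infinity>"
    using \<open>a < b\<close> by (simp_all add: \<tau>_def \<tau>\<^sub>1_def \<tau>\<^sub>2_def t\<^sub>1_def t\<^sub>2_def zero_extended_def)
  have 10: "monotone_pl_wrt {a..b} \<tau> F"
  proof (cases "\<epsilon> 1 = 1")
    case True
    have "\<forall>x\<in>{a..b}. F x = M (max (\<tau> x) 0)"
      using True \<tau> by (simp add: F)
    moreover have "mono_on (\<tau> ` {a..b}) (\<lambda>y. M (max y 0))"
      by (intro monotone_onI M_mono max.mono order_refl)
    moreover have "piecewise_linear_on (\<tau> ` {a..b}) (\<lambda>y. M (max y 0))"
      using affine_off_imp_piecewise_linear_on[OF _ affine_off_max_0[OF B(2)]] B(1) by simp
    ultimately show ?thesis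
      unfolding monotone_pl_wrt_def by (intro exI[of _ "\<lambda>y. M (max y 0)"] conjI disjI1)
  next
    case False
    have "\<forall>x\<in>{a..b}. F x = M (max (- \<tau> x) 0)"
      using False \<tau> by (simp add: F)
    moreover have "antimono_on (\<tau> ` {a..b}) (\<lambda>y. M (max (- y) 0))"
      by (intro monotone_onI M_mono max.mono order_refl) simp
    moreover have "piecewise_linear_on (\<tau> ` {a..b}) (\<lambda>y. M (max (- y) 0))"
      using affine_off_imp_piecewise_linear_on[OF _ affine_off_minus[OF affine_off_max_0[OF B(2)]]] B(1)
      by simp
    ultimately show ?thesis
      unfolding monotone_pl_wrt_def by (intro exI[of _ "\<lambda>y. M (max (- y) 0)"] conjI disjI2)
  qed
  have 11: "\<forall>x\<in>{a..b}. F x = M (max (zscale (\<epsilon> 1) (\<tau> x)) 0)"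
  \<comment> \<open>In degree 0 the sign \<open>\<epsilon> 1\<close> comes from the zero function
    and is unspecified; the formula then consists of \<open>\<nu> 0\<close> alone.\<close>
  proof (cases "d = 0")
    case True
    then show ?thesis
      by (simp add: F M_def min_formula_def)
  next
    case False
    then have "\<epsilon> 1 = 1 \<or> \<epsilon> 1 = -1"
      using \<epsilon> by simp
    then show ?thesis
      using \<tau> by (auto simp: F)
  qed
  have 12: "\<forall>x\<in>{a..b}. \<tau>\<^sub>1 x = max (\<tau> x) 0 \<and> \<tau>\<^sub>2 x = max (- \<tau> x) 0"
    using \<tau> by simp
  note facts = 1 2 3 4 5 6 7 8 9 10 11 12
  show ?thesis
    by (intro conjI; fact facts[unfolded F_def M_def])
qed

end
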